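(* Let $\Omega\subset\mathbb{C}$ be a bounded simply connected domain, let $\mu$ be a positive measure on $\Omega$, let $0<p\le q<\infty$ and $\alpha>-1$. The following are equivalent: (i) There is $c>0$ such that $\mu(B(z,r))\le c\, r^{(2+\alpha)q/p}$ for all Whitney balls $B(z,r)\subset\Omega$. (ii) For every $C>0$ there is $C'>0$ such that for every $C$-quasi-nearly subharmonic function $g\ge 0$ on $\Omega$, $$\left(\int_\Omega g(z)^q\,d\mu(z)\right)^{1/q}\le C'\left(\int_\Omega g(z)^p\,\delta_\Omega(z)^\alpha\,dm(z)\right)^{1/p}.$$ (iii) $\mu$ is a $q$-Carleson measure for $\mathcal{A}^p_\alpha(\Omega)$, i.e. there is $C''>0$ such that $\left(\int_\Omega|f|^q\,d\mu\right)^{1/q}\le C''\left(\int_\Omega|f(z)|^p\,\delta_\Omega(z)^\alpha\,dm(z)\right)^{1/p}$ for every analytic function $f$ on $\Omega$ with finite right-hand side.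
   Context: $dm$ is Lebesgue area measure and $\delta_\Omega(z)=\operatorname{dist}(z,\partial\Omega)$. A Whitney ball is a disc $B(z,r)\subset\Omega$ with $c_0\,\delta_\Omega(z)\le r\le\tfrac12\delta_\Omega(z)$, where $c_0\in(0,1/2]$ is a fixed constant. The weighted Bergman space $\mathcal{A}^p_\alpha(\Omega)$ consists of analytic $f$ on $\Omega$ with $\int_\Omega|f(z)|^p\delta_\Omega(z)^\alpha\,dm(z)<\infty$. A locally bounded measurable function $u\ge0$ on $\Omega$ is $C$-quasi-nearly subharmonic (also called $C$-quasi-subharmonic) if $u(a)\le \frac{C}{r^2}\int_{B(a,r)}u\,dm$ whenever the disc $B(a,r)\subset\Omega$. *)

theory Defs
  imports "HOL-Analysis.Analysis"
begin

text \<open>Real power of an extended nonnegative real, for a positive exponent e: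
  infinity is sent to infinity, finite values x to x powr e.\<close>
definition enn_powr :: "ennreal \<Rightarrow> real \<Rightarrow> ennreal" where
  "enn_powr x e = (if x = \<infinity> then \<infinity> else ennreal (enn2real x powr e))"

definition bdist :: "complex set \<Rightarrow> complex \<Rightarrow> real" where
  "bdist \<Omega> z = infdist z (frontier \<Omega>)"

definition quasi_nearly_subharmonic :: "real \<Rightarrow> complex set \<Rightarrow> (complex \<Rightarrow> real) \<Rightarrow> bool" where
  "quasi_nearly_subharmonic C \<Omega> u \<longleftrightarrow>
     set_borel_measurable lborel \<Omega> u \<and>
     (\<forall>z\<in>\<Omega>. 0 \<le> u z) \<and>
     (\<forall>z\<in>\<Omega>. \<exists>e>0. \<exists>M. \<forall>w\<in>ball z e \<inter> \<Omega>. u w \<le> M) \<and>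
     (\<forall>a r. 0 < r \<and> ball a r \<subseteq> \<Omega> \<longrightarrow>
        ennreal (u a) \<le> ennreal (C / r\<^sup>2) * (\<integral>\<^sup>+ z\<in>ball a r. ennreal (u z) \<partial>lborel))"

definition weighted_norm :: "complex set \<Rightarrow> real \<Rightarrow> real \<Rightarrow> (complex \<Rightarrow> real) \<Rightarrow> ennreal" where
  "weighted_norm \<Omega> p \<alpha> g =
     enn_powr (\<integral>\<^sup>+ z\<in>\<Omega>. ennreal (\<bar>g z\<bar> powr p * bdist \<Omega> z powr \<alpha>) \<partial>lborel) (1/p)"

definition meas_norm :: "complex measure \<Rightarrow> real \<Rightarrow> (complex \<Rightarrow> real) \<Rightarrow> ennreal" where
  "meas_norm \<mu> q g = enn_powr (\<integral>\<^sup>+ z. ennreal (\<bar>g z\<bar> powr q) \<partial>\<mu>) (1/q)"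

end

theory Submission
  imports Defs "HOL-Complex_Analysis.Complex_Analysis"
begin

text \<open>
  Whitney condition to embedding: every power \<open>u\<^bsup>p\<^esup>\<close> of a quasi-nearly subharmonic function satisfies a
  mean value inequality, so \<open>g\<^bsup>q\<^esup>(z)\<close> is bounded by a multiple of
  \<open>\<delta>(z)\<^bsup>-(2+\<alpha>)q/p\<^esup>\<close> times the integral of \<open>g\<^bsup>p\<^esup> \<delta>\<^bsup>\<alpha>\<^esup>\<close> over \<open>B(z, \<delta>(z)/3)\<close>, and Fubini's theorem
  reduces the embedding to the measure of Whitney balls. The modulus of an analytic function is
  quasi-nearly subharmonic. Conversely, powers of the derivative of a Riemann map are test functions
  for the Carleson condition; Schwarz-Pick and a Koebe-type estimate, deduced from Bloch's
  theorem, control them.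
\<close>

unbundle no fps_syntax

section \<open>Conformal change of variables\<close>

text \<open>The implications form a cycle (i) => (ii) => (iii) => (i), and uniformity of constants
  shapes each of them: over all g with the given C in (ii), over the centre of the Whitney ball in
  (iii) => (i). In (i) => (ii) the power q/p falls on a local integral, where Fubini cannot act
  directly. Since q >= p, all but one factor of it is bounded by the global integral, and what
  remains is linear. The exponent 2 + \<alpha> collects r^2 from the area mean and \<delta>^\<alpha>
  from the weight, r and \<delta> being comparable. In (iii) => (i) a test function must be large
  near a prescribed point while its norm stays bounded independently of that point. The Riemann map
  is therefore recentred there: the change of variables then always lands in the same integral over
  the disc, finite because \<alpha> > -1. Simple connectedness supplies both the map and a
  holomorphic logarithm of its derivative, hence its real powers. Comparing |\<phi>'| \<delta> with
  1 - |\<phi>|^2 from both sides is what covers weights of either sign of \<alpha>.\<close>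

definition cplx_of_vec :: "real^2 \<Rightarrow> complex" where
  "cplx_of_vec x = Complex (x$1) (x$2)"

definition vec_of_cplx :: "complex \<Rightarrow> real^2" where
  "vec_of_cplx z = vector [Re z, Im z]"

lemma cplx_of_vec_of_cplx [simp]: "cplx_of_vec (vec_of_cplx z) = z"
  by (simp add: cplx_of_vec_def vec_of_cplx_def)

lemma vec_of_cplx_of_vec [simp]: "vec_of_cplx (cplx_of_vec x) = x"
  by (simp add: cplx_of_vec_def vec_of_cplx_def vec_eq_iff forall_2)

lemma bounded_linear_cplx_of_vec: "bounded_linear cplx_of_vec"
  by (intro linear_conv_bounded_linear[THEN iffD1] linearI)
     (auto simp: cplx_of_vec_def complex_eq_iff)

lemma bounded_linear_vec_of_cplx: "bounded_linear vec_of_cplx"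
  by (intro linear_conv_bounded_linear[THEN iffD1] linearI)
     (auto simp: vec_of_cplx_def vec_eq_iff forall_2)

lemma continuous_on_cplx_of_vec: "continuous_on A cplx_of_vec"
  using bounded_linear_cplx_of_vec linear_continuous_on by blast

lemma borel_measurable_cplx_of_vec [measurable]: "cplx_of_vec \<in> borel_measurable borel"
  by (intro borel_measurable_continuous_onI continuous_on_cplx_of_vec)

text \<open>Lebesgue measure is determined by its values on boxes, and coordinate boxes correspond
  to each other with equal side lengths. This carries area integrals to \<open>real^2\<close>, where
  the change of variables theorem for Jacobian determinants applies.\<close>

lemma distr_lborel_cplx_of_vec: "lborel = distr lborel borel cplx_of_vec"
proof (rule lborel_eqI)
  fix l u :: complex assume lu: "\<And>b. b \<in> Basis \<Longrightarrow> l \<bullet> b \<le> u \<bullet> b"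
  have vimage: "cplx_of_vec -` box l u = box (vec_of_cplx l) (vec_of_cplx u)"
    by (auto simp: mem_box_cart forall_2 cplx_of_vec_def vec_of_cplx_def in_box_complex_iff)
  have B: "(Basis :: (real^2) set) = {axis 1 1, axis 2 1}"
    unfolding Basis_vec_def by (auto simp: UNIV_2)
  have ne: "axis 1 (1::real) \<noteq> (axis 2 1 :: real^2)" by (simp add: axis_eq_axis)
  have "Re l \<le> Re u" "Im l \<le> Im u"
    using lu[of 1] lu[of \<i>] by (simp_all add: Basis_complex_def)
  then have "\<And>b. b \<in> Basis \<Longrightarrow> vec_of_cplx l \<bullet> b \<le> vec_of_cplx u \<bullet> b"
    unfolding B by (auto simp: inner_axis vec_of_cplx_def)
  then have "emeasure lborel (box (vec_of_cplx l) (vec_of_cplx u)) =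
      (\<Prod>b\<in>Basis. (vec_of_cplx u - vec_of_cplx l) \<bullet> b)"
    by (rule emeasure_lborel_box)
  also have "(\<Prod>b\<in>Basis. (vec_of_cplx u - vec_of_cplx l) \<bullet> b) = (Re u - Re l) * (Im u - Im l)"
    using ne by (simp add: B inner_axis vec_of_cplx_def)
  finally show "emeasure (distr lborel borel cplx_of_vec) (box l u) = (\<Prod>b\<in>Basis. (u - l) \<bullet> b)"
    by (simp add: emeasure_distr vimage Basis_complex_def)
qed simp

lemma nn_integral_lborel_complex:
  assumes [measurable]: "f \<in> borel_measurable borel"
  shows "(\<integral>\<^sup>+ z. f z \<partial>lborel) = (\<integral>\<^sup>+ x. f (cplx_of_vec x) \<partial>lborel)"
  by (subst distr_lborel_cplx_of_vec, subst nn_integral_distr) auto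

lemma has_derivative_vec_conj:
  assumes "(\<phi> has_field_derivative d) (at (cplx_of_vec x))"
  shows "((\<lambda>x. vec_of_cplx (\<phi> (cplx_of_vec x))) has_derivative
           (\<lambda>v. vec_of_cplx (d * cplx_of_vec v))) (at x within A)"
proof -
  have "(\<phi> has_derivative (*) d) (at (cplx_of_vec x) within UNIV)"
    using assms by (simp add: has_field_derivative_def)
  then have "((\<phi> \<circ> cplx_of_vec) has_derivative ((*) d \<circ> cplx_of_vec)) (at x within A)"
    by (intro diff_chain_within bounded_linear_imp_has_derivative bounded_linear_cplx_of_vec)
       (auto intro: has_derivative_subset)
  from bounded_linear.has_derivative[OF bounded_linear_vec_of_cplx this]
  show ?thesis by (simp add: o_def)
qed

text \<open>Multiplication by x + iy has the real matrix with rows (x, -y) and (y, x), so the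
  Jacobian of a holomorphic map is the squared modulus of its derivative.\<close>

lemma det_matrix_vec_conj: "det (matrix (\<lambda>v. vec_of_cplx (d * cplx_of_vec v))) = (cmod d)\<^sup>2"
  by (simp add: det_2 matrix_def vec_of_cplx_def cplx_of_vec_def axis_def cmod_power2) (simp add: power2_eq_square)

text \<open>Only the inequality is stated: an infinite right-hand side is then trivial, and a finite
  one makes \<open>h\<close> absolutely integrable on the image, as the change of variables theorem
  requires.\<close>

lemma nn_integral_conformal_le:
  fixes h :: "complex \<Rightarrow> real"
  assumes S: "open S" and \<phi>: "\<phi> holomorphic_on S" and inj: "inj_on \<phi> S"
    and h [measurable]: "h \<in> borel_measurable borel" and h0: "\<And>w. 0 \<le> h w"
  shows "(\<integral>\<^sup>+ z\<in>S. ennreal ((cmod (deriv \<phi> z))\<^sup>2 * h (\<phi> z)) \<partial>lborel) \<le>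
         (\<integral>\<^sup>+ w\<in>\<phi> ` S. ennreal (h w) \<partial>lborel)"
proof (cases "(\<integral>\<^sup>+ w\<in>\<phi> ` S. ennreal (h w) \<partial>lborel) = \<infinity>")
  case False
  let ?J = cplx_of_vec and ?K = vec_of_cplx
  define T where "T = \<phi> ` S"
  define S' where "S' = ?J -` S"
  define G where "G = (\<lambda>x. ?K (\<phi> (?J x)))"
  \<comment> \<open>The change of variables theorem takes vector-valued integrands, so the scalar
    \<open>h\<close> is wrapped as a vector of length one.\<close>
  define h1 :: "real^2 \<Rightarrow> real^1" where "h1 = (\<lambda>x. vec (h (?J x)))"
  have T [measurable]: "T \<in> sets borel" and "open T"
    unfolding T_def using open_mapping_thm3[OF \<phi> S inj] by auto
  have "open S'" unfolding S'_def
    by (intro open_vimage S continuous_on_cplx_of_vec)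
  then have S'm: "S' \<in> sets lebesgue" "S' \<in> sets borel" by auto
  have T'm [measurable]: "?J -` T \<in> sets borel"
    using \<open>open T\<close> by (intro borel_open open_vimage continuous_on_cplx_of_vec)
  have GS: "G ` S' = ?J -` T"
  proof -
    have "x \<in> G ` S'" if "?J x \<in> T" for x
    proof -
      obtain z where z: "z \<in> S" "?J x = \<phi> z" using \<open>?J x \<in> T\<close> T_def by auto
      then have "x = G (?K z)" unfolding G_def by (metis cplx_of_vec_of_cplx vec_of_cplx_of_vec)
      then show ?thesis using z by (auto simp: S'_def)
    qed
    then show ?thesis by (auto simp: G_def S'_def T_def)
  qed
  have "inj_on G S'"
    unfolding G_def S'_def using inj
    by (intro inj_onI) (metis cplx_of_vec_of_cplx inj_onD vec_of_cplx_of_vec vimageD)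
  have der: "(G has_derivative (\<lambda>v. ?K (deriv \<phi> (?J x) * ?J v))) (at x within S')" if "x \<in> S'" for x
    unfolding G_def
    by (rule has_derivative_vec_conj) (use that \<phi> S holomorphic_derivI in \<open>auto simp: S'_def\<close>)
  have eq1: "(\<integral>\<^sup>+ w\<in>T. ennreal (h w) \<partial>lborel) = (\<integral>\<^sup>+ x\<in>?J -` T. ennreal (h (?J x)) \<partial>lborel)"
    by (subst nn_integral_lborel_complex) (auto simp: indicator_def intro!: nn_integral_cong)
  have fin: "(\<integral>\<^sup>+ x\<in>?J -` T. ennreal (h (?J x)) \<partial>lborel) < \<infinity>"
    using False eq1 by (simp add: T_def top.not_eq_extremum)
  have abs: "(\<lambda>x. h (?J x)) absolutely_integrable_on (?J -` T)"
    unfolding set_integrable_def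
  proof (rule integrable_completion[THEN iffD2])
    show "integrable lborel (\<lambda>x. indicat_real (?J -` T) x *\<^sub>R h (?J x))"
      unfolding integrable_iff_bounded
    proof
      show "(\<integral>\<^sup>+ x. ennreal (norm (indicat_real (?J -` T) x *\<^sub>R h (?J x))) \<partial>lborel) < \<infinity>"
        by (rule le_less_trans[OF _ fin]) (auto intro!: nn_integral_mono simp: indicator_def h0)
    qed measurable
  qed measurable
  define b where "b = integral (?J -` T) (\<lambda>x. h (?J x))"
  have hb: "((\<lambda>x. h (?J x)) has_integral b) (?J -` T)"
    unfolding b_def using abs set_lebesgue_integral_eq_integral(1) by blast
  have nb: "(\<integral>\<^sup>+ x\<in>?J -` T. ennreal (h (?J x)) \<partial>lborel) = ennreal b"
    by (rule nn_integral_has_integral_lebesgue') (use h0 hb in auto)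
  have "h1 absolutely_integrable_on (G ` S') \<and> integral (G ` S') h1 = vec b"
    using abs hb unfolding GS h1_def
    by (simp add: absolutely_integrable_on_1_iff integral_on_1_eq vec_eq_iff b_def)
  then have *: "(\<lambda>x. \<bar>det (matrix (\<lambda>v. ?K (deriv \<phi> (?J x) * ?J v)))\<bar> *\<^sub>R h1 (G x)) absolutely_integrable_on S' \<and>
        integral S' (\<lambda>x. \<bar>det (matrix (\<lambda>v. ?K (deriv \<phi> (?J x) * ?J v)))\<bar> *\<^sub>R h1 (G x)) = vec b"
    using has_absolute_integral_change_of_variables[OF S'm(1) der \<open>inj_on G S'\<close>, of h1 "vec b"] by blast
  then have "((\<lambda>x. (cmod (deriv \<phi> (?J x)))\<^sup>2 * h (\<phi> (?J x))) has_integral b) S'"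
    unfolding det_matrix_vec_conj h1_def G_def
    by (auto simp: absolutely_integrable_on_1_iff integral_on_1_eq vec_eq_iff has_integral_iff
          dest: set_lebesgue_integral_eq_integral(1))
  then have n2: "(\<integral>\<^sup>+ x\<in>S'. ennreal ((cmod (deriv \<phi> (?J x)))\<^sup>2 * h (\<phi> (?J x))) \<partial>lborel) = ennreal b"
    by (intro nn_integral_has_integral_lebesgue') (use h0 in auto)
  have m: "(\<lambda>z. ennreal ((cmod (deriv \<phi> z))\<^sup>2 * h (\<phi> z)) * indicator S z) \<in> borel_measurable borel"
  proof -
    have Sm: "S \<in> sets borel" using S by auto
    have "\<phi> \<in> borel_measurable (restrict_space borel S)"
         "deriv \<phi> \<in> borel_measurable (restrict_space borel S)"
      using holomorphic_on_imp_continuous_on[OF \<phi>] holomorphic_on_imp_continuous_on[OF holomorphic_deriv[OF \<phi> S]]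
      by (auto intro: borel_measurable_continuous_on_restrict)
    then have "(\<lambda>z. ennreal ((cmod (deriv \<phi> z))\<^sup>2 * h (\<phi> z))) \<in> borel_measurable (restrict_space borel S)"
      by measurable
    then show ?thesis using Sm by (simp add: borel_measurable_restrict_space_iff_ennreal)
  qed
  have "(\<integral>\<^sup>+ z\<in>S. ennreal ((cmod (deriv \<phi> z))\<^sup>2 * h (\<phi> z)) \<partial>lborel) = ennreal b"
    by (subst nn_integral_lborel_complex[OF m])
       (auto simp: S'_def indicator_def n2[symmetric] intro!: nn_integral_cong)
  then show ?thesis using nb eq1 by (simp add: T_def)
qed simp

section \<open>Analytic functions\<close>

text \<open>Cauchy's formula on the unit circle for u -> f(a + w u). Letting \<open>w\<close> be
  complex, and not just a radius, allows averaging over \<open>w\<close> in a disc later on, in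
  place of polar coordinates.\<close>

lemma holomorphic_le_circle_mean:
  assumes f: "f holomorphic_on ball a r" and w: "cmod w < r"
  shows "ennreal (cmod (f a)) \<le>
    (\<integral>\<^sup>+ t\<in>{0..1}. ennreal (cmod (f (a + w * exp (2 * of_real pi * \<i> * of_real t)))) \<partial>lborel)"
proof -
  define e where "e = (\<lambda>t::real. exp (2 * of_real pi * \<i> * of_real t) :: complex)"
  define F where "F = (\<lambda>u. f (a + w * u))"
  have sub: "a + w * u \<in> ball a r" if "cmod u \<le> 1" for u
  proof -
    have "cmod (w * u) \<le> cmod w" using that by (simp add: norm_mult mult_left_le)
    then show ?thesis using w by (simp add: dist_norm)
  qed
  have F: "F holomorphic_on cball 0 1"
    unfolding F_def
    by (rule holomorphic_on_compose_gen[OF _ f, unfolded o_def]) (auto intro!: holomorphic_intros sub)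
  have e: "cmod (e t) = 1" "e t \<noteq> 0" for t by (simp_all add: e_def)
  have circ: "circlepath 0 1 t = e t" for t by (simp add: circlepath e_def)
  have "((\<lambda>u. F u / (u - 0)) has_contour_integral (2 * of_real pi * \<i> * F 0)) (circlepath 0 1)"
    by (rule Cauchy_integral_circlepath_simple[OF F]) simp
  then have "((\<lambda>t. F (e t) / e t * (2 * of_real pi * \<i> * e t)) has_integral (2 * of_real pi * \<i> * F 0)) {0..1}"
    unfolding has_contour_integral_def
    by (rule has_integral_eq[rotated])
       (auto simp: circ vector_derivative_circlepath01 e_def mult_ac)
  then have "((\<lambda>t. F (e t) * (2 * of_real pi * \<i>)) has_integral (F 0 * (2 * of_real pi * \<i>))) {0..1}"
    using e by (simp add: mult_ac)
  from has_integral_mult_left[OF this, of "1 / (2 * of_real pi * \<i>)"]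
  have int: "((\<lambda>t. F (e t)) has_integral F 0) {0..1}" by simp
  have "continuous_on {0..1} e"
    unfolding e_def by (intro continuous_intros)
  then have "continuous_on {0..1} (\<lambda>t. cmod (F (e t)))"
    by (intro continuous_on_norm continuous_on_compose2[OF holomorphic_on_imp_continuous_on[OF F]])
       (simp_all add: image_subset_iff e)
  then have nint: "(\<lambda>t. cmod (F (e t))) integrable_on {0..1}"
    by (rule integrable_continuous_interval)
  have "cmod (f a) = cmod (integral {0..1} (\<lambda>t. F (e t)))"
    using int by (simp add: integral_unique F_def)
  also have "\<dots> \<le> integral {0..1} (\<lambda>t. cmod (F (e t)))"
    using int nint by (intro integral_norm_bound_integral) auto
  finally have "ennreal (cmod (f a)) \<le> ennreal (integral {0..1} (\<lambda>t. cmod (F (e t))))"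
    by (rule ennreal_leI)
  also have "\<dots> = (\<integral>\<^sup>+ t\<in>{0..1}. ennreal (cmod (F (e t))) \<partial>lborel)"
    using nn_integral_has_integral_lebesgue'[OF _ integrable_integral[OF nint]] by simp
  finally show ?thesis by (simp add: F_def e_def)
qed

lemma continuous_on_indicator_measurable:
  fixes g :: "complex \<Rightarrow> real"
  assumes "continuous_on S g" "open S"
  shows "(\<lambda>z. indicator S z * g z) \<in> borel_measurable borel"
  using borel_measurable_continuous_on_indicator[OF _ assms(1)] assms(2) by simp

text \<open>The circle mean is integrated over all \<open>w\<close> in the disc of radius
  \<open>r\<close> and the integrals are exchanged. For each fixed angle \<open>t\<close> the map w
  -> a + w e(t) is a rotation followed by a translation, hence preserves area, so every inner
  integral is the integral over \<open>ball a r\<close>.\<close>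

lemma holomorphic_le_area_mean:
  assumes f: "f holomorphic_on ball a r" and r: "0 < r"
  shows "ennreal (cmod (f a)) \<le>
    ennreal (1 / pi / r\<^sup>2) * (\<integral>\<^sup>+ z\<in>ball a r. ennreal (cmod (f z)) \<partial>lborel)"
proof -
  define e where "e = (\<lambda>t::real. exp (2 * of_real pi * \<i> * of_real t) :: complex)"
  have e: "cmod (e t) = 1" "e t \<noteq> 0" for t by (simp_all add: e_def)
  have [measurable]: "e \<in> borel_measurable borel"
    unfolding e_def by (intro borel_measurable_continuous_onI continuous_intros)
  define h where "h = (\<lambda>z. indicator (ball a r) z * cmod (f z))"
  have h [measurable]: "h \<in> borel_measurable borel"
    unfolding h_def using holomorphic_on_imp_continuous_on[OF f]
    by (intro continuous_on_indicator_measurable continuous_intros) auto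
  have h0: "0 \<le> h z" for z by (simp add: h_def)
  define I where "I = (\<integral>\<^sup>+ z\<in>ball a r. ennreal (cmod (f z)) \<partial>lborel)"
  have I: "I = (\<integral>\<^sup>+ z\<in>ball a r. ennreal (h z) \<partial>lborel)"
    unfolding I_def h_def by (intro nn_integral_cong) (simp add: indicator_def)
  have [measurable]: "ball (0::complex) r \<in> sets borel" by simp
  have mean: "ennreal (cmod (f a)) \<le> (\<integral>\<^sup>+ t\<in>{0..1}. ennreal (h (a + w * e t)) \<partial>lborel)"
    if "w \<in> ball 0 r" for w
  proof -
    have "a + w * e t \<in> ball a r" for t using that e by (simp add: dist_norm norm_mult)
    then show ?thesis
      using holomorphic_le_circle_mean[OF f, of w] that by (simp add: h_def e_def)
  qed
  have rot: "(\<integral>\<^sup>+ w\<in>ball 0 r. ennreal (h (a + w * e t)) \<partial>lborel) \<le> I" for t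
  proof -
    have img: "(\<lambda>w. a + w * e t) ` ball 0 r = ball a r"
    proof
      show "ball a r \<subseteq> (\<lambda>w. a + w * e t) ` ball 0 r"
      proof
        fix z assume z: "z \<in> ball a r"
        have "z = a + (z - a) / e t * e t" using e by simp
        moreover have "(z - a) / e t \<in> ball 0 r" using z e by (simp add: norm_divide dist_norm norm_minus_commute)
        ultimately show "z \<in> (\<lambda>w. a + w * e t) ` ball 0 r" by blast
      qed
    qed (auto simp: dist_norm norm_mult e)
    have d: "deriv (\<lambda>w. a + w * e t) w = e t" for w
      by (rule DERIV_imp_deriv) (auto intro!: derivative_eq_intros)
    have "(\<integral>\<^sup>+ w\<in>ball 0 r. ennreal ((cmod (deriv (\<lambda>w. a + w * e t) w))\<^sup>2 * h (a + w * e t)) \<partial>lborel) \<le>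
       (\<integral>\<^sup>+ z\<in>(\<lambda>w. a + w * e t) ` ball 0 r. ennreal (h z) \<partial>lborel)"
      by (rule nn_integral_conformal_le) (use e h0 in \<open>auto intro!: holomorphic_intros inj_onI\<close>)
    then show ?thesis by (simp add: img d e I)
  qed
  have "ennreal (cmod (f a)) * emeasure lborel (ball (0::complex) r) =
        (\<integral>\<^sup>+ w. ennreal (cmod (f a)) * indicator (ball (0::complex) r) w \<partial>lborel)"
    by (simp add: nn_integral_cmult_indicator)
  also have "\<dots> \<le> (\<integral>\<^sup>+ w. (\<integral>\<^sup>+ t. ennreal (h (a + w * e t)) * indicator {0..1} t *
        indicator (ball 0 r) w \<partial>lborel) \<partial>lborel)"
    using mean by (intro nn_integral_mono) (auto simp: indicator_def)
  also have "\<dots> = (\<integral>\<^sup>+ t. (\<integral>\<^sup>+ w. ennreal (h (a + w * e t)) * indicator {0..1} t *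
        indicator (ball 0 r) w \<partial>lborel) \<partial>lborel)"
    by (rule lborel_pair.Fubini') measurable
  also have "\<dots> \<le> (\<integral>\<^sup>+ t. I * indicator {0..1} t \<partial>(lborel :: real measure))"
    using rot by (intro nn_integral_mono) (auto simp: indicator_def)
  also have "\<dots> = I" by (simp add: nn_integral_cmult_indicator)
  finally have *: "ennreal (cmod (f a)) * ennreal (pi * r\<^sup>2) \<le> I"
    using r by (simp add: emeasure_ball unit_ball_vol_2)
  have "ennreal (cmod (f a)) = ennreal (1 / pi / r\<^sup>2) * (ennreal (cmod (f a)) * ennreal (pi * r\<^sup>2))"
    using r by (simp add: ennreal_mult[symmetric])
  also have "\<dots> \<le> ennreal (1 / pi / r\<^sup>2) * I" by (intro mult_left_mono *) simp
  finally show ?thesis by (simp add: I_def)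
qed

lemma quasi_nearly_subharmonic_cmod:
  assumes \<Omega>: "open \<Omega>" and f: "f holomorphic_on \<Omega>"
  shows "quasi_nearly_subharmonic (1 / pi) \<Omega> (\<lambda>z. cmod (f z))"
proof -
  have cont: "continuous_on \<Omega> (\<lambda>z. cmod (f z))"
    using f by (intro continuous_intros holomorphic_on_imp_continuous_on)
  have "\<exists>e>0. \<exists>M. \<forall>w\<in>ball z e \<inter> \<Omega>. cmod (f w) \<le> M" if z: "z \<in> \<Omega>" for z
  proof -
    obtain e where e: "0 < e" "\<And>w. w \<in> \<Omega> \<Longrightarrow> dist w z < e \<Longrightarrow> dist (cmod (f w)) (cmod (f z)) < 1"
      using cont z unfolding continuous_on_iff by (metis zero_less_one)
    have "\<forall>w\<in>ball z e \<inter> \<Omega>. cmod (f w) \<le> cmod (f z) + 1"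
      using e(2) by (force simp: dist_commute dist_real_def)
    then show ?thesis using e(1) by blast
  qed
  then show ?thesis
    unfolding quasi_nearly_subharmonic_def set_borel_measurable_def
    using continuous_on_indicator_measurable[OF cont \<Omega>]
      holomorphic_le_area_mean holomorphic_on_subset[OF f] by auto
qed

section \<open>Powers of quasi-nearly subharmonic functions\<close>

lemma qnsD:
  assumes "quasi_nearly_subharmonic C \<Omega> u"
  shows "(\<lambda>z. indicator \<Omega> z * u z) \<in> borel_measurable borel"
    and "z \<in> \<Omega> \<Longrightarrow> 0 \<le> u z"
    and "z \<in> \<Omega> \<Longrightarrow> \<exists>e>0. \<exists>M. \<forall>w\<in>ball z e \<inter> \<Omega>. u w \<le> M"
    and "0 < r \<Longrightarrow> ball a r \<subseteq> \<Omega> \<Longrightarrow>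
        ennreal (u a) \<le> ennreal (C / r\<^sup>2) * (\<integral>\<^sup>+ z\<in>ball a r. ennreal (u z) \<partial>lborel)"
  using assms by (auto simp: quasi_nearly_subharmonic_def set_borel_measurable_def)

text \<open>Measurability of \<open>u\<close> is known only relative to \<Omega>; inserting the
  indicator of \<Omega> before taking the power makes the integrand Borel on the whole
  plane.\<close>

lemma qns_powr_measurable:
  assumes "quasi_nearly_subharmonic C \<Omega> u" "S \<subseteq> \<Omega>" "S \<in> sets borel"
  shows "(\<lambda>z. ennreal (u z powr p) * indicator S z) \<in> borel_measurable borel"
proof -
  note [measurable] = qnsD(1)[OF assms(1)] assms(3)
  have "(\<lambda>z. ennreal (u z powr p) * indicator S z) =
        (\<lambda>z. ennreal ((indicator \<Omega> z * u z) powr p) * indicator S z)"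
    using assms(2) by (auto simp: indicator_def fun_eq_iff)
  then show ?thesis by simp
qed

text \<open>Local boundedness and a finite subcover. It guarantees that the supremum in the case p
  <= 1 is finite, so that it can be absorbed.\<close>

lemma qns_bounded_on_compact:
  assumes qns: "quasi_nearly_subharmonic C \<Omega> u" and K: "compact K" "K \<subseteq> \<Omega>"
  obtains B where "\<And>z. z \<in> K \<Longrightarrow> u z \<le> B"
proof -
  obtain e M where eM: "\<And>z. z \<in> K \<Longrightarrow> 0 < e z \<and> (\<forall>w\<in>ball z (e z) \<inter> \<Omega>. u w \<le> M z)"
    using qnsD(3)[OF qns] K(2) by (metis subsetD)
  have "K \<subseteq> (\<Union>z\<in>K. ball z (e z))" using eM by fastforce
  then obtain T where T: "T \<subseteq> K" "finite T" "K \<subseteq> (\<Union>z\<in>T. ball z (e z))"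
    using compactE_image[OF K(1), of K "\<lambda>z. ball z (e z)"] by auto
  have "u w \<le> (\<Sum>z\<in>T. \<bar>M z\<bar>)" if w: "w \<in> K" for w
  proof -
    obtain z where z: "z \<in> T" "w \<in> ball z (e z)" using T(3) w by auto
    then have "u w \<le> M z" using eM[of z] T(1) K(2) w by blast
    also have "\<dots> \<le> (\<Sum>z\<in>T. \<bar>M z\<bar>)"
      using member_le_sum[OF z(1), of "\<lambda>z. \<bar>M z\<bar>"] T(2) by simp
    finally show ?thesis .
  qed
  then show ?thesis using that by blast
qed

text \<open>In place of Jensen's inequality, u <= l + l^(1-p) u^p holds for every l > 0, by
  comparing u with l. A suitable level l lets the first term be absorbed into the left-hand
  side.\<close>

lemma qns_powr_mean_ge_1:
  assumes p: "1 \<le> p" and C: "0 < C" and qns: "quasi_nearly_subharmonic C \<Omega> u"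
    and r: "0 < r" and sub: "ball a r \<subseteq> \<Omega>"
  shows "ennreal (u a powr p) \<le>
    ennreal (2 * C * (2 * C * pi) powr (p - 1) / r\<^sup>2) * (\<integral>\<^sup>+ z\<in>ball a r. ennreal (u z powr p) \<partial>lborel)"
    (is "_ \<le> ennreal ?K * ?I")
proof (cases "?I = \<infinity> \<or> u a = 0")
  case True
  then show ?thesis using C r by (auto simp: ennreal_mult_top)
next
  case False
  have "a \<in> \<Omega>" using r sub by auto
  then have ua: "0 < u a" using qnsD(2)[OF qns] False by fastforce
  define J where "J = enn2real ?I"
  have J: "?I = ennreal J" "0 \<le> J" using False by (auto simp: J_def top.not_eq_extremum)
  \<comment> \<open>The level is chosen so that C / r^2 times l times the area of the disc equals
    exactly u(a) / 2.\<close>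
  define l where "l = u a / (2 * C * pi)"
  have l: "0 < l" using ua C by (simp add: l_def)
  have [measurable]: "(\<lambda>z. ennreal (u z powr p) * indicator (ball a r) z) \<in> borel_measurable borel"
    using qns_powr_measurable[OF qns sub] by simp
  have "(\<integral>\<^sup>+ z\<in>ball a r. ennreal (u z) \<partial>lborel) \<le>
        (\<integral>\<^sup>+ z. ennreal l * indicator (ball a r) z +
           ennreal (l powr (1 - p)) * (ennreal (u z powr p) * indicator (ball a r) z) \<partial>lborel)"
  proof (rule nn_integral_mono)
    fix z
    have "u z \<le> l + l powr (1 - p) * u z powr p" if "z \<in> ball a r"
    proof (cases "u z \<le> l")
      case False
      then have "(l / u z) powr (p - 1) \<le> 1" using l p by (intro powr_le1) auto
      then have "1 \<le> l powr (1 - p) * u z powr (p - 1)"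
        using l False by (simp add: powr_divide powr_diff divide_simps powr_minus mult.commute)
      then have "u z * 1 \<le> u z * (l powr (1 - p) * u z powr (p - 1))"
        using False l by (intro mult_left_mono) auto
      also have "\<dots> = l powr (1 - p) * u z powr p"
        using False l by (simp add: powr_diff)
      finally show ?thesis using l by simp
    qed (simp add: add_increasing2)
    then show "ennreal (u z) * indicator (ball a r) z \<le> ennreal l * indicator (ball a r) z +
           ennreal (l powr (1 - p)) * (ennreal (u z powr p) * indicator (ball a r) z)"
      using l by (auto simp: indicator_def ennreal_mult[symmetric] ennreal_plus[symmetric] simp del: ennreal_plus
          intro!: ennreal_leI)
  qed
  also have "\<dots> = ennreal l * emeasure lborel (ball a r) + ennreal (l powr (1 - p)) * ?I"
    by (subst nn_integral_add) (measurable, simp_all add: nn_integral_cmult nn_integral_cmult_indicator)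
  also have "\<dots> = ennreal (l * (pi * r\<^sup>2) + l powr (1 - p) * J)"
    using l r J by (simp add: emeasure_ball unit_ball_vol_2 ennreal_mult[symmetric] ennreal_plus[symmetric] del: ennreal_plus)
  finally have "ennreal (u a) \<le> ennreal (C / r\<^sup>2) * ennreal (l * (pi * r\<^sup>2) + l powr (1 - p) * J)"
    using qnsD(4)[OF qns r sub] by (meson mult_left_mono order_trans zero_le)
  then have "u a \<le> C / r\<^sup>2 * (l * (pi * r\<^sup>2) + l powr (1 - p) * J)"
    using l J C r by (simp add: ennreal_mult[symmetric] del: ennreal_plus)
  also have "\<dots> = u a / 2 + C / r\<^sup>2 * (l powr (1 - p) * J)"
    using r C by (simp add: l_def field_simps)
  finally have "u a \<le> 2 * C / r\<^sup>2 * (l powr (1 - p) * J)" by simp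
  then have "u a * u a powr (p - 1) \<le> 2 * C / r\<^sup>2 * (l powr (1 - p) * J) * u a powr (p - 1)"
    by (intro mult_right_mono) auto
  also have "\<dots> = ?K * J"
  proof -
    have "l powr (1 - p) * u a powr (p - 1) = (2 * C * pi) powr (p - 1)"
      using ua C by (simp add: l_def powr_divide powr_diff)
    then show ?thesis by (simp add: field_simps)
  qed
  finally have "u a powr p \<le> ?K * J" using ua by (simp add: powr_diff)
  then show ?thesis using J C by (simp add: ennreal_mult[symmetric] ennreal_leI)
qed

text \<open>The weight \<open>(\<rho> - |w - a|)\<^bsup>2/p\<^esup>\<close> makes the supremum absorb the factor
  \<open>u\<^bsup>1-p\<^esup>\<close> that is split off from \<open>u = u\<^bsup>p\<^esup> u\<^bsup>1-p\<^esup>\<close>.\<close>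

lemma qns_powr_mean_le_1:
  assumes p: "0 < p" "p \<le> 1" and C: "0 < C" and qns: "quasi_nearly_subharmonic C \<Omega> u"
    and r: "0 < r" and sub: "ball a r \<subseteq> \<Omega>"
  shows "ennreal (u a powr p) \<le>
    ennreal (4 * (2 powr (2 / p) * C) / r\<^sup>2) * (\<integral>\<^sup>+ z\<in>ball a r. ennreal (u z powr p) \<partial>lborel)"
    (is "_ \<le> ennreal ?K * ?I")
proof (cases "?I = \<infinity> \<or> u a = 0")
  case True
  then show ?thesis using C r by (auto simp: ennreal_mult_top)
next
  case False
  define J where "J = enn2real ?I"
  have J: "?I = ennreal J" "0 \<le> J" using False by (auto simp: J_def top.not_eq_extremum)
  \<comment> \<open>Halving the radius puts a compact disc inside \<Omega>, on which
    \<open>u\<close> is bounded; the price is the factor 4 in the final constant.\<close>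
  define \<rho> where "\<rho> = r / 2"
  have \<rho>: "0 < \<rho>" "cball a \<rho> \<subseteq> ball a r" using r by (auto simp: \<rho>_def)
  have u0: "0 \<le> u z" if "z \<in> ball a r" for z using that sub qnsD(2)[OF qns] by auto
  have ua: "0 < u a" using u0[of a] r False by auto
  obtain B where B: "\<And>z. z \<in> cball a \<rho> \<Longrightarrow> u z \<le> B"
    using qns_bounded_on_compact[OF qns compact_cball] \<rho>(2) sub by (meson order_trans)
  define V where "V = (\<lambda>w. (\<rho> - dist a w) powr (2 / p) * u w)"
  define M where "M = (SUP w\<in>ball a \<rho>. V w)"
  have "V w \<le> \<rho> powr (2 / p) * B" if "w \<in> ball a \<rho>" for w
    unfolding V_def using that p B[of w] u0[of w] \<rho> by (intro mult_mono powr_mono2) (auto simp: \<rho>_def)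
  then have "bdd_above (V ` ball a \<rho>)" by (meson bdd_aboveI2)
  then have VM: "V w \<le> M" if "w \<in> ball a \<rho>" for w
    using that unfolding M_def by (meson cSUP_upper)
  have Va: "V a = \<rho> powr (2 / p) * u a" by (simp add: V_def)
  have "0 < V a" using \<rho> ua by (simp add: Va)
  then have M0: "0 < M" using VM[of a] \<rho> by simp
  define D where "D = 2 powr (2 / p) * C"
  have D0: "0 < D" using C by (simp add: D_def)
  have main: "V w \<le> D * M powr (1 - p) * J" if w: "w \<in> ball a \<rho>" for w
  proof -
    \<comment> \<open>With half the distance to the rim as radius, each point of
      \<open>ball w s\<close> keeps distance at least \<open>s\<close> from the rim, so the
      definition of \<open>M\<close> gives u <= M s^(-2/p) there.\<close>
    define s where "s = (\<rho> - dist a w) / 2"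
    have s: "0 < s" using w by (simp add: s_def)
    have far: "s \<le> \<rho> - dist a z" if "z \<in> ball w s" for z
      using that dist_triangle[of a z w] by (simp add: s_def field_simps)
    have ws: "ball w s \<subseteq> ball a \<rho>" using far s by fastforce
    then have wr: "ball w s \<subseteq> ball a r" using \<rho>(2) by (meson ball_subset_cball order_trans)
    define L where "L = (M * s powr (- 2 / p)) powr (1 - p)"
    have "u z \<le> L * u z powr p" if z: "z \<in> ball w s" for z
    proof -
      have uz: "0 \<le> u z" using u0 wr z by auto
      have "s powr (2 / p) * u z \<le> V z" unfolding V_def
        using far[OF z] s p uz by (intro mult_right_mono powr_mono2) auto
      also have "\<dots> \<le> M" using VM ws z by auto
      finally have "u z \<le> M * s powr (- 2 / p)" using s by (simp add: powr_minus field_simps)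
      then have "u z powr (1 - p) \<le> L" unfolding L_def using p uz by (intro powr_mono2) auto
      then have "u z powr (1 - p) * u z powr p \<le> L * u z powr p" by (intro mult_right_mono) auto
      then show ?thesis using uz by (simp add: powr_add[symmetric])
    qed
    then have "(\<integral>\<^sup>+ z\<in>ball w s. ennreal (u z) \<partial>lborel) \<le>
       (\<integral>\<^sup>+ z. ennreal L * (ennreal (u z powr p) * indicator (ball a r) z) \<partial>lborel)"
      using wr by (intro nn_integral_mono)
        (auto simp: indicator_def L_def ennreal_mult[symmetric] intro!: ennreal_leI)
    also have "\<dots> = ennreal L * ?I"
      using qns_powr_measurable[OF qns sub, of p] by (intro nn_integral_cmult) auto
    also have "\<dots> = ennreal (L * J)" using J by (simp add: L_def ennreal_mult)
    finally have "ennreal (u w) \<le> ennreal (C / s\<^sup>2) * ennreal (L * J)"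
      using qnsD(4)[OF qns s, of w] wr sub by (meson mult_left_mono order_trans zero_le)
    then have "u w \<le> C / s\<^sup>2 * (L * J)"
      using s C J by (simp add: L_def ennreal_mult[symmetric])
    then have "(2 * s) powr (2 / p) * u w \<le> (2 * s) powr (2 / p) * (C / s\<^sup>2 * (L * J))"
      by (intro mult_left_mono) auto
    also have "\<dots> = D * M powr (1 - p) * J * (s powr (2 / p) * s powr (- 2) * s powr (- 2 / p * (1 - p)))"
    proof -
      have "s powr (- 2) = 1 / s\<^sup>2" using s by (simp add: powr_minus divide_simps)
      moreover have "L = M powr (1 - p) * s powr (- 2 / p * (1 - p))"
        using M0 by (simp add: L_def powr_mult powr_powr)
      ultimately show ?thesis using s by (simp add: D_def powr_mult)
    qed
    \<comment> \<open>The exponents 2/p, -2 and -(2/p)(1 - p) sum to 0. This cancellation dictates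
      the exponent 2/p of the weight.\<close>
    also have "s powr (2 / p) * s powr (- 2) * s powr (- 2 / p * (1 - p)) = 1"
      using s p by (simp add: powr_add[symmetric]) (simp add: field_simps)
    finally have "(2 * s) powr (2 / p) * u w \<le> D * M powr (1 - p) * J" by simp
    moreover have "2 * s = \<rho> - dist a w" by (simp add: s_def)
    ultimately show ?thesis by (simp add: V_def)
  qed
  have "M \<le> D * M powr (1 - p) * J"
    unfolding M_def by (rule cSUP_least) (use \<rho> main in \<open>auto simp: M_def\<close>)
  \<comment> \<open>Dividing by M^(1-p) is legitimate because M is positive and finite.\<close>
  then have "M powr p \<le> D * J" using M0 by (simp add: powr_diff field_simps)
  have "\<rho>\<^sup>2 * u a powr p = (V a) powr p"
    using \<rho> ua p by (simp add: Va powr_mult powr_powr)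
  also have "\<dots> \<le> M powr p" using VM[of a] \<rho> \<open>0 < V a\<close> p by (intro powr_mono2) auto
  also have "\<dots> \<le> D * J" by fact
  finally have "u a powr p \<le> ?K * J" using r by (simp add: \<rho>_def D_def power2_eq_square field_simps)
  then show ?thesis using J C by (simp add: ennreal_mult[symmetric] ennreal_leI)
qed

text \<open>The order of quantifiers is the point: \<open>K\<close> depends on \<open>p\<close> and
  \<open>C\<close> alone, which later makes the embedding constant uniform in
  \<open>g\<close>.\<close>

lemma qns_powr_mean:
  assumes "0 < p" "0 < C"
  obtains K where "0 < K" "\<And>\<Omega> u a r. quasi_nearly_subharmonic C \<Omega> u \<Longrightarrow> 0 < r \<Longrightarrow> ball a r \<subseteq> \<Omega> \<Longrightarrow>
    ennreal (u a powr p) \<le> ennreal (K / r\<^sup>2) * (\<integral>\<^sup>+ z\<in>ball a r. ennreal (u z powr p) \<partial>lborel)"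
proof (cases "1 \<le> p")
  case True
  show ?thesis
    by (rule that[of "2 * C * (2 * C * pi) powr (p - 1)"])
       (use qns_powr_mean_ge_1[OF True assms(2)] assms in auto)
next
  case False
  show ?thesis
    by (rule that[of "4 * (2 powr (2 / p) * C)"])
       (use qns_powr_mean_le_1[of p C] False assms in auto)
qed

section \<open>Distortion of conformal maps onto the disc\<close>

lemma Moebius_has_field_derivative_centre:
  assumes "cmod a < 1"
  shows "(Moebius_function 0 a has_field_derivative 1 / of_real (1 - (cmod a)\<^sup>2)) (at a)"
proof -
  have "(cmod a)\<^sup>2 < 1" using assms by (simp add: abs_square_less_1)
  then have ne: "1 - cnj a * a = of_real (1 - (cmod a)\<^sup>2)" "1 - cnj a * a \<noteq> 0"
    by (metis complex_norm_square mult.commute of_real_1 of_real_diff)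
       (metis \<open>(cmod a)\<^sup>2 < 1\<close> complex_norm_square less_irrefl mult.commute of_real_eq_1_iff right_minus_eq)
  have "((\<lambda>z. (z - a) / (1 - cnj a * z)) has_field_derivative 1 / (1 - cnj a * a)) (at a)"
    using ne(2) by (auto intro!: derivative_eq_intros simp: divide_simps)
  then show ?thesis using ne(1) by (simp add: Moebius_function_def[abs_def])
qed

lemma Moebius_has_field_derivative_0:
  "(Moebius_function 0 (- a) has_field_derivative of_real (1 - (cmod a)\<^sup>2)) (at 0)"
proof -
  have "((\<lambda>z. (z - (- a)) / (1 - cnj (- a) * z)) has_field_derivative 1 - a * cnj a) (at 0)"
    by (auto intro!: derivative_eq_intros)
  then show ?thesis by (simp add: Moebius_function_def[abs_def] complex_norm_square del: of_real_power)
qed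

text \<open>The Schwarz lemma applies after rescaling \<open>ball z d\<close> to the unit disc and
  following \<phi> by the Moebius map that sends \<phi>(z) to 0; the latter contributes the factor 1
  / (1 - |\<phi>(z)|^2).\<close>

lemma Schwarz_Pick_deriv:
  assumes \<phi>: "\<phi> holomorphic_on ball z d" and d: "0 < d"
    and \<phi>1: "\<And>w. w \<in> ball z d \<Longrightarrow> cmod (\<phi> w) < 1"
  shows "cmod (deriv \<phi> z) * d \<le> 1 - (cmod (\<phi> z))\<^sup>2"
proof -
  define a where "a = \<phi> z"
  have a: "cmod a < 1" using \<phi>1 d by (simp add: a_def)
  have a2: "(cmod a)\<^sup>2 < 1" using a by (simp add: abs_square_less_1)
  have sub: "z + of_real d * w \<in> ball z d" if "cmod w < 1" for w
    using that d by (simp add: dist_norm norm_mult)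
  define h where "h = (\<lambda>w. Moebius_function 0 a (\<phi> (z + of_real d * w)))"
  have hol1: "(\<lambda>w. \<phi> (z + of_real d * w)) holomorphic_on ball 0 1"
    by (rule holomorphic_on_compose_gen[OF _ \<phi>, unfolded o_def]) (auto intro!: holomorphic_intros sub)
  have "h holomorphic_on ball 0 1"
    unfolding h_def
    by (rule holomorphic_on_compose_gen[OF hol1 Moebius_function_holomorphic[OF a], unfolded o_def])
       (use sub \<phi>1 in auto)
  moreover have "h 0 = 0" by (simp add: h_def a_def Moebius_function_eq_zero)
  moreover have "cmod (h w) < 1" if "cmod w < 1" for w
    unfolding h_def by (intro Moebius_function_norm_lt_1 a \<phi>1 sub that)
  ultimately have le: "cmod (deriv h 0) \<le> 1"
    using Schwarz_Lemma(2)[of h 0] by simp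
  have "(\<phi> has_field_derivative deriv \<phi> z) (at (z + of_real d * 0))"
    using holomorphic_derivI[OF \<phi>] d by simp
  then have "((\<lambda>w. \<phi> (z + of_real d * w)) has_field_derivative deriv \<phi> z * of_real d) (at 0)"
    by (rule DERIV_chain2) (auto intro!: derivative_eq_intros)
  then have "(h has_field_derivative 1 / of_real (1 - (cmod a)\<^sup>2) * (deriv \<phi> z * of_real d)) (at 0)"
    unfolding h_def
    by (rule DERIV_chain2[rotated]) (use Moebius_has_field_derivative_centre[OF a] in \<open>simp add: a_def\<close>)
  then have "deriv h 0 = deriv \<phi> z * of_real d / of_real (1 - (cmod a)\<^sup>2)"
    by (simp add: DERIV_imp_deriv)
  then have "cmod (deriv h 0) = cmod (deriv \<phi> z) * d / (1 - (cmod a)\<^sup>2)"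
    using d a2 by (simp only: norm_divide norm_mult norm_of_real) simp
  then show ?thesis using le a2 by (simp add: a_def)
qed

text \<open>A weak form of Koebe's quarter theorem. A branch of \<open>log (\<eta> - \<zeta>)\<close> is injective and so is its
  exponential, hence its image contains no disc of radius exceeding \<open>\<pi>\<close>, whereas Bloch's theorem
  provides discs of radius proportional to the derivative.\<close>

lemma univalent_deriv_le_dist_omitted:
  assumes \<eta>: "\<eta> holomorphic_on ball 0 1" and inj: "inj_on \<eta> (ball 0 1)"
    and \<zeta>: "\<zeta> \<notin> \<eta> ` ball 0 1"
  shows "cmod (deriv \<eta> 0) \<le> 13 * pi * dist (\<eta> 0) \<zeta>"
proof -
  have "simply_connected (ball (0::complex) 1)"
    by (simp add: convex_imp_simply_connected)
  moreover have "(\<lambda>z. \<eta> z - \<zeta>) holomorphic_on ball 0 1" "\<forall>z\<in>ball 0 1. \<eta> z - \<zeta> \<noteq> 0"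
    using \<eta> \<zeta> by (auto intro!: holomorphic_intros)
  ultimately obtain L where L: "L holomorphic_on ball 0 1" "\<And>z. z \<in> ball 0 1 \<Longrightarrow> \<eta> z - \<zeta> = exp (L z)"
    using simply_connected_eq_holomorphic_log[of "ball 0 1"] by fastforce
  have "(L has_field_derivative deriv L 0) (at 0)"
    by (rule holomorphic_derivI[OF L(1)]) auto
  then have "((\<lambda>z. exp (L z)) has_field_derivative exp (L 0) * deriv L 0) (at 0)"
    by (auto intro!: derivative_eq_intros)
  then have "((\<lambda>z. \<eta> z - \<zeta>) has_field_derivative exp (L 0) * deriv L 0) (at 0)"
    by (rule has_field_derivative_transform_within_open[where S = "ball 0 1"]) (use L(2) in auto)
  moreover have "((\<lambda>z. \<eta> z - \<zeta>) has_field_derivative deriv \<eta> 0) (at 0)"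
    using holomorphic_derivI[OF \<eta>, of 0] by (auto intro!: derivative_eq_intros)
  ultimately have d: "deriv \<eta> 0 = (\<eta> 0 - \<zeta>) * deriv L 0"
    using L(2)[of 0] DERIV_unique by fastforce
  have "cmod (deriv L 0) \<le> 13 * pi"
  proof (rule ccontr)
    assume *: "\<not> ?thesis"
    \<comment> \<open>Bloch's theorem yields a disc of radius |L'(0)| / 12 in the image; the
      constant 13 makes this strictly larger than pi. The points b + i pi and b - i pi of the disc
      then have the same exponential, contradicting injectivity of \<eta>.\<close>
    define r where "r = cmod (deriv L 0) / 12"
    have r: "pi < r" using * pi_gt_zero unfolding r_def by linarith
    obtain b where b: "ball b r \<subseteq> L ` ball 0 1"
      using Bloch_general[OF L(1), of 0 1 r] by (auto simp: r_def frontier_ball dist_norm)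
    have "b + of_real pi * \<i> \<in> ball b r" "b - of_real pi * \<i> \<in> ball b r"
      using r by (simp_all add: dist_norm norm_mult)
    then have "b + of_real pi * \<i> \<in> L ` ball 0 1" "b - of_real pi * \<i> \<in> L ` ball 0 1"
      using b by blast+
    then obtain z1 z2 where z: "z1 \<in> ball 0 1" "z2 \<in> ball 0 1"
      "b + of_real pi * \<i> = L z1" "b - of_real pi * \<i> = L z2"
      by (elim imageE)
    have "exp (L z1) = exp (L z2)"
      unfolding z(3,4)[symmetric] by (simp add: exp_add exp_diff)
    then have "\<eta> z1 = \<eta> z2" using L(2) z(1,2) by (metis diff_add_cancel)
    then have "z1 = z2" using inj z(1,2) by (auto dest: inj_onD)
    then have "b + of_real pi * \<i> = b - of_real pi * \<i>" using z(3,4) by simp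
    then show False by (simp add: complex_eq_iff)
  qed
  then show ?thesis
    unfolding d norm_mult dist_norm by (metis mult.commute mult_right_mono norm_ge_zero)
qed

text \<open>Precomposing the inverse \<open>g\<close> with the Moebius map that takes 0 to \<phi>(z)
  gives a univalent \<eta> with \<eta>(0) = z that omits \<zeta>. Its derivative at 0 has modulus (1
  - |\<phi>(z)|^2) / |\<phi>'(z)|, so the weak Koebe bound becomes the claim.\<close>

lemma conformal_deriv_ge_dist_frontier:
  assumes \<Omega>: "open \<Omega>" and \<phi>: "\<phi> holomorphic_on \<Omega>" and g: "g holomorphic_on ball 0 1"
    and \<phi>g: "\<And>z. z \<in> \<Omega> \<Longrightarrow> \<phi> z \<in> ball 0 1 \<and> g (\<phi> z) = z"
    and g\<phi>: "\<And>w. w \<in> ball 0 1 \<Longrightarrow> g w \<in> \<Omega> \<and> \<phi> (g w) = w"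
    and z: "z \<in> \<Omega>" and \<zeta>: "\<zeta> \<notin> \<Omega>"
  shows "1 - (cmod (\<phi> z))\<^sup>2 \<le> 13 * pi * dist z \<zeta> * cmod (deriv \<phi> z)"
proof -
  define a where "a = \<phi> z"
  have a: "cmod a < 1" using \<phi>g z by (auto simp: a_def)
  have a2: "(cmod a)\<^sup>2 < 1" using a by (simp add: abs_square_less_1)
  have a': "cmod (- a) < 1" using a by simp
  let ?M = "Moebius_function 0 (- a)"
  have M1: "?M w \<in> ball 0 1" if "w \<in> ball 0 1" for w
    using Moebius_function_norm_lt_1[OF a'] that by simp
  have M0: "?M 0 = a" by (simp add: Moebius_function_def)
  define \<eta> where "\<eta> = (\<lambda>w. g (?M w))"
  have hol: "\<eta> holomorphic_on ball 0 1"
    unfolding \<eta>_def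
    by (rule holomorphic_on_compose_gen[OF Moebius_function_holomorphic[OF a'] g, unfolded o_def])
       (use M1 in auto)
  have inj: "inj_on \<eta> (ball 0 1)"
  proof (rule inj_on_inverseI)
    fix w :: complex assume w: "w \<in> ball 0 1"
    have "\<phi> (\<eta> w) = ?M w" using g\<phi> M1[OF w] by (simp add: \<eta>_def)
    \<comment> \<open>The inverse Moebius map after \<phi> is a left inverse of \<eta>, which gives
      injectivity.\<close>
    then show "Moebius_function 0 a (\<phi> (\<eta> w)) = w"
      using Moebius_function_compose[of a "- a" w] a w by simp
  qed
  have "\<zeta> \<notin> \<eta> ` ball 0 1" using \<zeta> g\<phi> M1 by (auto simp: \<eta>_def)
  then have le: "cmod (deriv \<eta> 0) \<le> 13 * pi * dist (\<eta> 0) \<zeta>"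
    by (rule univalent_deriv_le_dist_omitted[OF hol inj])
  have \<eta>0: "\<eta> 0 = z" unfolding \<eta>_def M0 using \<phi>g z by (simp add: a_def)
  have dg: "(g has_field_derivative deriv g a) (at a)"
    by (rule holomorphic_derivI[OF g]) (use a in auto)
  have "(\<eta> has_field_derivative deriv g a * of_real (1 - (cmod a)\<^sup>2)) (at 0)"
    unfolding \<eta>_def
    by (rule DERIV_chain2[OF _ Moebius_has_field_derivative_0]) (use dg in \<open>simp add: M0\<close>)
  then have d\<eta>: "deriv \<eta> 0 = deriv g a * of_real (1 - (cmod a)\<^sup>2)"
    by (rule DERIV_imp_deriv)
  have "((\<lambda>w. g (\<phi> w)) has_field_derivative deriv g a * deriv \<phi> z) (at z)"
    by (rule DERIV_chain2) (use dg holomorphic_derivI[OF \<phi> \<Omega> z] in \<open>auto simp: a_def\<close>)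
  then have "((\<lambda>w. w) has_field_derivative deriv g a * deriv \<phi> z) (at z)"
    by (rule has_field_derivative_transform_within_open[OF _ \<Omega> z]) (use \<phi>g in auto)
  then have one: "deriv g a * deriv \<phi> z = 1"
    using DERIV_unique DERIV_ident by blast
  have "1 - (cmod a)\<^sup>2 = cmod (deriv g a * deriv \<phi> z) * (1 - (cmod a)\<^sup>2)"
    by (simp add: one)
  also have "\<dots> = cmod (deriv \<eta> 0) * cmod (deriv \<phi> z)"
    unfolding d\<eta> norm_mult norm_of_real using a2 by simp
  also have "\<dots> \<le> 13 * pi * dist z \<zeta> * cmod (deriv \<phi> z)"
    using le by (intro mult_right_mono) (auto simp: \<eta>0)
  finally show ?thesis by (simp add: a_def)
qed

text \<open>For \<alpha> < 0 the singularity at the circle is summed dyadically in 1 - |w|^2. The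
  region where this is at most 2^-k has area pi 2^-k, so the series is geometric with ratio 2^-(1 +
  \<alpha>), below 1 because \<alpha> > -1.\<close>

lemma nn_integral_disc_powr_finite:
  fixes \<alpha> :: real
  assumes \<alpha>: "-1 < \<alpha>"
  shows "(\<integral>\<^sup>+ w\<in>ball (0::complex) 1. ennreal ((1 - (cmod w)\<^sup>2) powr \<alpha>) \<partial>lborel) < \<infinity>"
proof (cases "0 \<le> \<alpha>")
  case True
  have "(\<integral>\<^sup>+ w\<in>ball (0::complex) 1. ennreal ((1 - (cmod w)\<^sup>2) powr \<alpha>) \<partial>lborel) \<le>
        (\<integral>\<^sup>+ w. indicator (ball (0::complex) 1) w \<partial>lborel)"
  proof (rule nn_integral_mono)
    fix w :: complex
    have "(1 - (cmod w)\<^sup>2) powr \<alpha> \<le> 1" if "cmod w < 1"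
      using that True by (intro powr_le1) (auto simp: abs_square_le_1)
    then show "ennreal ((1 - (cmod w)\<^sup>2) powr \<alpha>) * indicator (ball 0 1) w \<le> indicator (ball 0 1) w"
      by (auto simp: indicator_def ennreal_le_1)
  qed
  also have "\<dots> < \<infinity>" by (simp add: emeasure_ball)
  finally show ?thesis .
next
  case False
  \<comment> \<open>These regions are nested, not disjoint annuli; this suffices, since the
    integrand need only be dominated by one term of a series of nonnegative terms.\<close>
  define A where "A = (\<lambda>k::nat. ball (0::complex) 1 - ball 0 (sqrt (1 - (1/2)^k)))"
  define c where "c = (\<lambda>k::nat. ((1/2::real) ^ Suc k) powr \<alpha>)"
  define x where "x = (1/2::real) powr (1 + \<alpha>)"
  have x: "0 \<le> x" "x < 1" using \<alpha> powr_less_mono2[of "1 + \<alpha>" "1/2::real" 1] by (auto simp: x_def)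
  have [measurable]: "A k \<in> sets borel" for k by (auto simp: A_def)
  have A: "emeasure lborel (A k) = ennreal (pi * (1/2)^k)" for k
  proof -
    define s where "s = sqrt (1 - (1/2::real)^k)"
    have k: "(1/2::real)^k \<le> 1" by (simp add: power_le_one)
    have s: "0 \<le> s" "s \<le> 1" "s\<^sup>2 = 1 - (1/2)^k" using k by (simp_all add: s_def)
    have "emeasure lborel (A k) = emeasure lborel (ball (0::complex) 1) - emeasure lborel (ball (0::complex) s)"
      unfolding A_def s_def[symmetric]
      by (rule emeasure_Diff) (use s in \<open>simp_all add: emeasure_ball subset_ball\<close>)
    also have "\<dots> = ennreal (pi - pi * s\<^sup>2)"
      using s(1) by (simp add: emeasure_ball unit_ball_vol_2 ennreal_minus)
    also have "pi - pi * s\<^sup>2 = pi * (1/2)^k" unfolding s(3) by (simp add: algebra_simps)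
    finally show ?thesis .
  qed
  have "(\<integral>\<^sup>+ w\<in>ball (0::complex) 1. ennreal ((1 - (cmod w)\<^sup>2) powr \<alpha>) \<partial>lborel) \<le>
        (\<integral>\<^sup>+ w. (\<Sum>k. ennreal (c k) * indicator (A k) w) \<partial>lborel)"
  proof (rule nn_integral_mono)
    fix w :: complex
    show "ennreal ((1 - (cmod w)\<^sup>2) powr \<alpha>) * indicator (ball 0 1) w \<le> (\<Sum>k. ennreal (c k) * indicator (A k) w)"
    proof (cases "w \<in> ball 0 1")
      case True
      define y where "y = 1 - (cmod w)\<^sup>2"
      have y: "0 < y" "y \<le> 1" using True by (auto simp: y_def abs_square_less_1)
      \<comment> \<open>As y <= 1, the least such index is a successor \<open>Suc k\<close>, and
        minimality gives 2^-(k+1) < y <= 2^-k. The lower end bounds y^\<alpha> because \<alpha> is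
        negative.\<close>
      define n where "n = (LEAST n. (1/2::real)^n < y)"
      have n: "(1/2)^n < y" unfolding n_def
        by (rule LeastI_ex) (use real_arch_pow_inv[of y "1/2"] y in auto)
      then obtain k where k: "n = Suc k" using y by (cases n) auto
      have "y \<le> (1/2)^k" using not_less_Least[of k "\<lambda>n. (1/2::real)^n < y"] k by (auto simp: n_def)
      then have "1 - (1/2)^k \<le> (cmod w)\<^sup>2" by (simp add: y_def)
      then have "sqrt (1 - (1/2)^k) \<le> cmod w" by (simp add: real_le_lsqrt)
      then have wA: "w \<in> A k" using True by (simp add: A_def)
      have "y powr \<alpha> \<le> c k" unfolding c_def using n k False y
        by (intro powr_mono2') auto
      then have "ennreal (y powr \<alpha>) \<le> ennreal (c k) * indicator (A k) w" using wA by (simp add: ennreal_leI)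
      also have "\<dots> = (\<Sum>j\<in>{k}. ennreal (c j) * indicator (A j) w)"
        by (simp only: sum.insert finite.emptyI empty_iff not_False_eq_True sum.empty add_0_right)
      also have "\<dots> \<le> (\<Sum>k. ennreal (c k) * indicator (A k) w)"
        by (rule sum_le_suminf) auto
      finally show ?thesis using True by (simp add: y_def)
    qed simp
  qed
  also have "\<dots> = (\<Sum>k. ennreal (c k) * ennreal (pi * (1/2)^k))"
    by (subst nn_integral_suminf) (auto simp: nn_integral_cmult_indicator A)
  also have "\<dots> = (\<Sum>k. ennreal (pi * (1/2) powr \<alpha> * x ^ k))"
  proof (rule suminf_cong)
    fix k
    have "c k = (1/2) powr (\<alpha> * real (Suc k))"
      unfolding c_def by (simp only: powr_realpow[symmetric] powr_powr zero_less_divide_1_iff zero_less_numeral mult.commute)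
    moreover have "x ^ k = (1/2) powr ((1 + \<alpha>) * real k)"
      unfolding x_def by (simp add: powr_realpow[symmetric] powr_powr)
    moreover have "(1/2::real) ^ k = (1/2) powr (real k)" by (simp add: powr_realpow)
    ultimately have eq: "c k * (pi * (1/2)^k) = pi * (1/2) powr \<alpha> * x ^ k"
      by (simp add: powr_add[symmetric] algebra_simps)
    have "ennreal (c k) * ennreal (pi * (1/2)^k) = ennreal (c k * (pi * (1/2)^k))"
      by (rule ennreal_mult[symmetric]) (auto simp: c_def)
    then show "ennreal (c k) * ennreal (pi * (1/2)^k) = ennreal (pi * (1/2) powr \<alpha> * x ^ k)"
      by (simp only: eq)
  qed
  also have "\<dots> < \<infinity>"
  proof -
    have "summable (\<lambda>k. pi * (1/2) powr \<alpha> * x ^ k)"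
      using x by (intro summable_mult summable_geometric) auto
    then show ?thesis using x by (subst suminf_ennreal2) auto
  qed
  finally show ?thesis .
qed

section \<open>Distance to the boundary and the embedding\<close>

lemma bdist_le_dist: "\<zeta> \<in> frontier \<Omega> \<Longrightarrow> bdist \<Omega> z \<le> dist z \<zeta>"
  unfolding bdist_def by (rule infdist_le)

lemma bdist_nonneg: "0 \<le> bdist \<Omega> z"
  unfolding bdist_def by (rule infdist_nonneg)

lemma bdist_lipschitz: "bdist \<Omega> w \<le> bdist \<Omega> z + dist z w"
  unfolding bdist_def by (metis dist_commute infdist_triangle)

lemma borel_measurable_bdist [measurable]: "bdist \<Omega> \<in> borel_measurable borel"
  unfolding bdist_def by (intro borel_measurable_continuous_onI continuous_intros)

text \<open>A ball is connected, so if it started in \<Omega> and left it, it would meet the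
  frontier at a distance smaller than the infimum.\<close>

lemma ball_bdist_subset:
  assumes "z \<in> \<Omega>"
  shows "ball z (bdist \<Omega> z) \<subseteq> \<Omega>"
proof (rule ccontr)
  assume *: "\<not> ?thesis"
  then have "0 < bdist \<Omega> z" by (metis ball_eq_empty empty_subsetI not_le)
  then have "z \<in> ball z (bdist \<Omega> z) \<inter> \<Omega>" using assms by simp
  then have "ball z (bdist \<Omega> z) \<inter> frontier \<Omega> \<noteq> {}"
    using * by (intro connected_Int_frontier) blast+
  then obtain v where "dist z v < bdist \<Omega> z" "v \<in> frontier \<Omega>" by auto
  then show False using bdist_le_dist[of v \<Omega> z] by simp
qed

text \<open>A nonempty bounded set has nonempty frontier, so the default value 0 of
  \<open>infdist\<close> for the empty set does not occur; openness places the nearest frontier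
  point outside \<Omega>.\<close>

lemma bdist_attained:
  assumes "open \<Omega>" "bounded \<Omega>" "\<Omega> \<noteq> {}"
  obtains \<zeta> where "\<zeta> \<notin> \<Omega>" "dist z \<zeta> = bdist \<Omega> z"
proof -
  have ne: "frontier \<Omega> \<noteq> {}"
    using assms by (metis frontier_eq_empty not_bounded_UNIV)
  obtain \<zeta> where "\<zeta> \<in> frontier \<Omega>" "infdist z (frontier \<Omega>) = dist z \<zeta>"
    using infdist_attains_inf[OF frontier_closed ne] by blast
  moreover have "frontier \<Omega> \<inter> \<Omega> = {}"
    using assms(1) by (auto simp: frontier_def interior_open)
  ultimately show ?thesis using that by (auto simp: bdist_def)
qed

lemma bdist_pos:
  assumes "open \<Omega>" "bounded \<Omega>" "z \<in> \<Omega>"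
  shows "0 < bdist \<Omega> z"
  using bdist_attained[OF assms(1,2), of z] assms(3) by (metis empty_iff zero_less_dist_iff)

section \<open>Powers of extended nonnegative reals\<close>

lemma enn_powr_ennreal: "0 \<le> x \<Longrightarrow> enn_powr (ennreal x) e = ennreal (x powr e)"
  by (simp add: enn_powr_def)

lemma enn_powr_mono:
  assumes "x \<le> y" "0 \<le> e"
  shows "enn_powr x e \<le> enn_powr y e"
proof (cases "y = \<infinity>")
  case False
  then have "x \<noteq> \<infinity>" using assms(1) by (auto simp: top_unique)
  then show ?thesis using False assms
    by (auto simp: enn_powr_def top.not_eq_extremum intro!: ennreal_leI powr_mono2 enn2real_mono)
qed (simp add: enn_powr_def)

lemma enn_powr_inverse_leD:
  assumes "enn_powr x (1 / q) \<le> ennreal R" "0 < q" "0 \<le> R"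
  shows "x \<le> ennreal (R powr q)"
proof (cases x)
  case (real y)
  then have "y powr (1 / q) \<le> R" using assms by (simp add: enn_powr_ennreal)
  then have "(y powr (1 / q)) powr q \<le> R powr q" using assms by (intro powr_mono2) auto
  then show ?thesis using real assms by (simp add: powr_powr ennreal_leI)
qed (use assms in \<open>auto simp: enn_powr_def top_unique\<close>)

text \<open>In the double integral below, \<open>z\<close> lies within \<open>\<delta>(z)/3\<close> of \<open>w\<close> only if it lies in the Whitney
  ball \<open>B(w, \<delta>(w)/2)\<close>, so no covering argument is needed.\<close>

lemma whitney_imp_qns_embedding:
  assumes \<Omega>: "open \<Omega>" "bounded \<Omega>" and sets: "sets \<mu> = sets (restrict_space lborel \<Omega>)"
    and pq: "0 < p" "p \<le> q" and \<alpha>: "-1 < \<alpha>" and c: "0 < c" and C: "0 < C"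
    and W: "\<And>w. w \<in> \<Omega> \<Longrightarrow>
      emeasure \<mu> (ball w (bdist \<Omega> w / 2)) \<le> ennreal (c * (bdist \<Omega> w / 2) powr ((2 + \<alpha>) * q / p))"
  shows "\<exists>C'>0. \<forall>g. quasi_nearly_subharmonic C \<Omega> g \<longrightarrow>
              meas_norm \<mu> q g \<le> ennreal C' * weighted_norm \<Omega> p \<alpha> g"
proof -
  define \<gamma> where "\<gamma> = (2 + \<alpha>) * q / p"
  have \<gamma>: "0 < \<gamma>" using pq \<alpha> by (simp add: \<gamma>_def)
  let ?d = "bdist \<Omega>"
  note pos = bdist_pos[OF \<Omega>]
  have space: "space \<mu> = \<Omega>"
    using sets_eq_imp_space_eq[OF sets] by (simp add: space_restrict_space)
  have \<Omega>m [measurable]: "\<Omega> \<in> sets borel" using \<Omega> by simp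
  have [measurable]: "ball z r \<in> sets borel" for z :: complex and r by simp
  have openm: "U \<in> sets \<mu>" if "open U" "U \<subseteq> \<Omega>" for U
    unfolding sets using that by (auto simp: sets_restrict_space image_iff intro!: exI[of _ U])
  have ballm: "ball w (?d w / 2) \<subseteq> \<Omega>" if "w \<in> \<Omega>" for w
    using ball_bdist_subset[OF that] pos[OF that] by (auto simp: subset_iff)
  \<comment> \<open>Fubini needs sigma-finiteness of \<mu>, which follows from the Whitney bound: by
    Lindelof countably many of the balls, each of finite measure, cover \<Omega>.\<close>
  have sf: "sigma_finite_measure \<mu>"
  proof -
    define F where "F = (\<lambda>w. ball w (?d w / 2)) ` \<Omega>"
    obtain F' where F': "F' \<subseteq> F" "countable F'" "\<Union>F' = \<Union>F"
      using Lindelof[of F] by (auto simp: F_def)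
    have "w \<in> ball w (?d w / 2)" if "w \<in> \<Omega>" for w using pos[OF that] by simp
    then have UF: "\<Union>F = \<Omega>" using ballm unfolding F_def by blast
    show ?thesis
    proof (rule sigma_finite_measure.intro, intro exI[of _ F'] conjI ballI)
      show "F' \<subseteq> sets \<mu>" using F'(1) openm ballm by (auto simp: F_def)
      show "emeasure \<mu> U \<noteq> \<infinity>" if U: "U \<in> F'" for U
      proof -
        obtain w where "w \<in> \<Omega>" "U = ball w (?d w / 2)" using U F'(1) by (auto simp: F_def)
        then show ?thesis using W[of w] by (auto simp: top_unique)
      qed
    qed (use F' UF space in auto)
  qed
  interpret pair_sigma_finite \<mu> "lborel :: complex measure"
    using sf lborel.sigma_finite_measure_axioms by (rule pair_sigma_finite.intro)
  have restr: "f \<in> borel_measurable \<mu>" if "f \<in> borel_measurable borel" for f :: "complex \<Rightarrow> complex"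
    unfolding measurable_cong_sets[OF sets refl] using that by (intro measurable_restrict_space1) simp
  \<comment> \<open>The kernel of the double integral: for fixed \<open>z\<close> it integrates over
    the mean value disc, for fixed \<open>w\<close> over the points whose disc reaches
    \<open>w\<close>.\<close>
  define R where "R = (\<lambda>z w. if dist z w < ?d z / 3 then ennreal (?d z powr (- \<gamma>)) else 0)"
  have R [measurable]: "case_prod R \<in> borel_measurable (\<mu> \<Otimes>\<^sub>M lborel)"
  proof -
    have "(\<lambda>x. x) \<in> measurable \<mu> borel" by (rule restr) simp
    then have pair: "(\<lambda>x. (fst x, snd x)) \<in> measurable (\<mu> \<Otimes>\<^sub>M lborel) (borel \<Otimes>\<^sub>M borel)"
      by (intro measurable_Pair measurable_compose[OF measurable_fst]) auto
    have "case_prod R \<in> borel_measurable (borel \<Otimes>\<^sub>M borel)"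
      unfolding R_def by measurable
    from measurable_compose[OF pair this] show ?thesis by (simp only: prod.collapse)
  qed
  have Rw: "(\<lambda>z. R z w) \<in> borel_measurable \<mu>" for w
    using measurable_compose[OF measurable_Pair2' R, of w] by simp
  obtain K where K: "0 < K" and Kmean: "\<And>u a r. quasi_nearly_subharmonic C \<Omega> u \<Longrightarrow> 0 < r \<Longrightarrow> ball a r \<subseteq> \<Omega> \<Longrightarrow>
      ennreal (u a powr p) \<le> ennreal (K / r\<^sup>2) * (\<integral>\<^sup>+ z\<in>ball a r. ennreal (u z powr p) \<partial>lborel)"
    using qns_powr_mean[OF pq(1) C] by metis
  \<comment> \<open>On B(z, \<delta>(z)/3) the distances \<delta>(z) and \<delta>(w) differ by a
    factor of at most 2, so \<open>m\<close> compares their powers for either sign of \<alpha>. The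
    9 in \<open>K1\<close> comes from the radius \<delta>(z)/3.\<close>
  define m where "m = (2::real) powr \<bar>\<alpha>\<bar>"
  define K1 where "K1 = 9 * K * m"
  have K1: "0 < K1" using K by (simp add: K1_def m_def)
  have inner: "(\<integral>\<^sup>+ z. R z w \<partial>\<mu>) \<le> ennreal c"
    if w: "w \<in> \<Omega>" for w
  proof -
    have "(\<integral>\<^sup>+ z. R z w \<partial>\<mu>) \<le>
      (\<integral>\<^sup>+ z. ennreal ((?d w / 2) powr (- \<gamma>)) * indicator (ball w (?d w / 2)) z \<partial>\<mu>)"
    proof (rule nn_integral_mono)
      fix z assume "z \<in> space \<mu>"
      \<comment> \<open>The Lipschitz bound gives \<delta>(w) > (2/3) \<delta>(z) and \<delta>(w) <
        (4/3) \<delta>(z). The radius 1/3 is tuned so that the first of these turns \<delta>(z)/3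
        into \<delta>(w)/2.\<close>
      have "dist z w < ?d w / 2 \<and> ?d w / 2 \<le> ?d z" if "dist z w < ?d z / 3"
        using that bdist_lipschitz[of \<Omega> w z] bdist_lipschitz[of \<Omega> z w] by (simp add: dist_commute)
      moreover have "?d z powr (- \<gamma>) \<le> (?d w / 2) powr (- \<gamma>)" if "?d w / 2 \<le> ?d z"
        using that pos[OF w] \<gamma> by (intro powr_mono2') auto
      ultimately show "R z w \<le>
          ennreal ((?d w / 2) powr (- \<gamma>)) * indicator (ball w (?d w / 2)) z"
        by (auto simp: R_def indicator_def dist_commute intro!: ennreal_leI)
    qed
    also have "\<dots> = ennreal ((?d w / 2) powr (- \<gamma>)) * emeasure \<mu> (ball w (?d w / 2))"
      using openm[OF open_ball ballm[OF w]] by (simp add: nn_integral_cmult_indicator)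
    also have "\<dots> \<le> ennreal ((?d w / 2) powr (- \<gamma>)) * ennreal (c * (?d w / 2) powr \<gamma>)"
      using W[OF w] by (intro mult_left_mono) (auto simp: \<gamma>_def)
    also have "\<dots> = ennreal c"
      using pos[OF w] c by (simp add: ennreal_mult[symmetric] powr_minus)
    finally show ?thesis .
  qed
  define C' where "C' = (c * K1 powr (q / p)) powr (1 / q)"
  have "0 < C'" using c K1 by (simp add: C'_def)
  moreover have "meas_norm \<mu> q g \<le> ennreal C' * weighted_norm \<Omega> p \<alpha> g"
    if qns: "quasi_nearly_subharmonic C \<Omega> g" for g
  proof -
    note g0 = qnsD(2)[OF qns]
    define I where "I = (\<integral>\<^sup>+ z\<in>\<Omega>. ennreal (\<bar>g z\<bar> powr p * ?d z powr \<alpha>) \<partial>lborel)"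
    show ?thesis
    proof (cases "I = \<infinity>")
      case True
      then show ?thesis using \<open>0 < C'\<close>
        by (simp add: weighted_norm_def I_def enn_powr_def ennreal_mult_top)
    next
      case False
      define J where "J = enn2real I"
      have J: "I = ennreal J" "0 \<le> J" using False by (auto simp: J_def top.not_eq_extremum)
      \<comment> \<open>Nothing is known about \<open>g\<close> outside \<Omega>, so the density is
        cut off there to obtain a globally Borel, nonnegative function.\<close>
      define G where "G = (\<lambda>w. indicator \<Omega> w * ((indicator \<Omega> w * g w) powr p * ?d w powr \<alpha>))"
      note [measurable] = qnsD(1)[OF qns]
      have G [measurable]: "G \<in> borel_measurable borel" unfolding G_def by measurable
      have IG: "I = (\<integral>\<^sup>+ w. ennreal (G w) \<partial>lborel)"
        unfolding I_def G_def by (intro nn_integral_cong) (auto simp: indicator_def g0)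
      define N where "N = (\<lambda>z. \<integral>\<^sup>+ w\<in>ball z (?d z / 3). ennreal (G w) \<partial>lborel)"
      have NI: "N z \<le> I" for z
        unfolding N_def IG by (intro nn_integral_mono) (auto simp: indicator_def)
      have pw: "ennreal (g z powr p) \<le> ennreal (K1 * ?d z powr (- (2 + \<alpha>))) * N z" if z: "z \<in> \<Omega>" for z
      proof -
        note dz = pos[OF z]
        have sub: "ball z (?d z / 3) \<subseteq> \<Omega>"
          using ball_bdist_subset[OF z] dz by (auto simp: subset_iff)
        have "(\<integral>\<^sup>+ w\<in>ball z (?d z / 3). ennreal (g w powr p) \<partial>lborel) \<le>
          (\<integral>\<^sup>+ w. ennreal (m * ?d z powr (- \<alpha>)) * (ennreal (G w) * indicator (ball z (?d z / 3)) w) \<partial>lborel)"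
        proof (rule nn_integral_mono)
          fix w
          have "g w powr p \<le> m * ?d z powr (- \<alpha>) * G w" if w: "w \<in> ball z (?d z / 3)"
          proof -
            have w\<Omega>: "w \<in> \<Omega>" using w sub by auto
            note dw = pos[OF w\<Omega>]
            have cmp: "?d z \<le> 2 * ?d w" "?d w \<le> 2 * ?d z"
              using w bdist_lipschitz[of \<Omega> w z] bdist_lipschitz[of \<Omega> z w] by (auto simp: dist_commute)
            have "?d z powr \<alpha> \<le> m * ?d w powr \<alpha>"
            proof (cases "0 \<le> \<alpha>")
              case True
              then have "?d z powr \<alpha> \<le> (2 * ?d w) powr \<alpha>" using cmp dz by (intro powr_mono2) auto
              then show ?thesis using True dw by (simp add: m_def powr_mult)
            next
              case False
              then have "?d z powr \<alpha> \<le> (?d w / 2) powr \<alpha>" using cmp dw by (intro powr_mono2') auto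
              then show ?thesis using False dw by (simp add: m_def powr_divide powr_minus field_simps)
            qed
            then have "1 \<le> m * ?d z powr (- \<alpha>) * ?d w powr \<alpha>"
              using dz by (simp add: powr_minus field_simps)
            then have "g w powr p * 1 \<le> g w powr p * (m * ?d z powr (- \<alpha>) * ?d w powr \<alpha>)"
              by (intro mult_left_mono) auto
            then show ?thesis using w\<Omega> by (simp add: G_def mult_ac)
          qed
          then show "ennreal (g w powr p) * indicator (ball z (?d z / 3)) w \<le>
              ennreal (m * ?d z powr (- \<alpha>)) * (ennreal (G w) * indicator (ball z (?d z / 3)) w)"
            by (auto simp: indicator_def ennreal_mult[symmetric] m_def G_def intro!: ennreal_leI)
        qed
        also have "\<dots> = ennreal (m * ?d z powr (- \<alpha>)) * N z"
          unfolding N_def by (intro nn_integral_cmult) measurable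
        finally have "ennreal (g z powr p) \<le>
            ennreal (K / (?d z / 3)\<^sup>2) * (ennreal (m * ?d z powr (- \<alpha>)) * N z)"
          using Kmean[OF qns _ sub] dz by (meson divide_pos_pos mult_left_mono order_trans zero_le zero_less_numeral)
        also have "\<dots> = ennreal (K / (?d z / 3)\<^sup>2 * (m * ?d z powr (- \<alpha>))) * N z"
          using K by (subst ennreal_mult[of "K / (?d z / 3)\<^sup>2"]) (auto simp: m_def mult.assoc)
        also have "K / (?d z / 3)\<^sup>2 * (m * ?d z powr (- \<alpha>)) = K1 * ?d z powr (- (2 + \<alpha>))"
        proof -
          have e: "- (2 + \<alpha>) = - \<alpha> - 2" by simp
          have "?d z powr (- (2 + \<alpha>)) = ?d z powr (- \<alpha>) / (?d z)\<^sup>2"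
            unfolding e using dz powr_diff[of "?d z" "- \<alpha>" 2] by (simp add: powr_numeral)
          then show ?thesis by (simp add: K1_def power_divide)
        qed
        finally show ?thesis .
      qed
      define B where "B = K1 powr (q / p) * J powr (q / p - 1)"
      have qw: "ennreal (\<bar>g z\<bar> powr q) \<le> ennreal B * (ennreal (?d z powr (- \<gamma>)) * N z)" if z: "z \<in> \<Omega>" for z
      proof -
        define n where "n = enn2real (N z)"
        have "N z \<noteq> \<infinity>" using NI[of z] False by (auto simp: top_unique)
        then have n: "N z = ennreal n" "0 \<le> n" by (auto simp: n_def top.not_eq_extremum)
        have nJ: "n \<le> J" using NI[of z] n J by simp
        have le: "g z powr p \<le> K1 * ?d z powr (- (2 + \<alpha>)) * n"
          using pw[OF z] n K1 by (simp add: ennreal_mult[symmetric])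
        \<comment> \<open>This is where p <= q enters: the local integral is at most the global one,
          so the surplus power is moved to \<open>J\<close> and the bound becomes linear in
          \<open>N z\<close>.\<close>
        have nle: "n powr (q / p) \<le> J powr (q / p - 1) * n"
        proof (cases "n = 0")
          case False
          then have "n powr (q / p) = n powr (q / p - 1) * n" using n by (simp add: powr_diff)
          also have "\<dots> \<le> J powr (q / p - 1) * n"
            using n nJ pq by (intro mult_right_mono powr_mono2) auto
          finally show ?thesis .
        qed simp
        have e: "- (2 + \<alpha>) * (q / p) = - \<gamma>" using pq by (simp add: \<gamma>_def field_simps)
        have "g z powr q = (g z powr p) powr (q / p)" using pq by (simp add: powr_powr)
        also have "\<dots> \<le> (K1 * ?d z powr (- (2 + \<alpha>)) * n) powr (q / p)"
          using le pq by (intro powr_mono2) auto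
        also have "\<dots> = K1 powr (q / p) * ?d z powr (- \<gamma>) * n powr (q / p)"
          unfolding e[symmetric] using K1 n by (simp add: powr_mult powr_powr)
        also have "\<dots> \<le> K1 powr (q / p) * ?d z powr (- \<gamma>) * (J powr (q / p - 1) * n)"
          using nle by (intro mult_left_mono) auto
        finally have "g z powr q \<le> B * (?d z powr (- \<gamma>) * n)"
          by (simp add: B_def mult_ac)
        then show ?thesis using n g0[OF z] K1
          by (simp add: ennreal_mult[symmetric] B_def ennreal_leI)
      qed
      have "(\<integral>\<^sup>+ z. ennreal (\<bar>g z\<bar> powr q) \<partial>\<mu>) \<le>
          (\<integral>\<^sup>+ z. ennreal B * (\<integral>\<^sup>+ w. R z w * ennreal (G w) \<partial>lborel) \<partial>\<mu>)"
      proof (rule nn_integral_mono)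
        fix z assume "z \<in> space \<mu>"
        then have z: "z \<in> \<Omega>" by (simp add: space)
        have "ennreal (?d z powr (- \<gamma>)) * N z =
          (\<integral>\<^sup>+ w. ennreal (?d z powr (- \<gamma>)) * (ennreal (G w) * indicator (ball z (?d z / 3)) w) \<partial>lborel)"
          unfolding N_def by (intro nn_integral_cmult[symmetric]) measurable
        also have "\<dots> = (\<integral>\<^sup>+ w. R z w * ennreal (G w) \<partial>lborel)"
          by (intro nn_integral_cong) (auto simp: R_def indicator_def)
        finally show "ennreal (\<bar>g z\<bar> powr q) \<le> ennreal B * (\<integral>\<^sup>+ w. R z w * ennreal (G w) \<partial>lborel)"
          using qw[OF z] by simp
      qed
      also have "\<dots> = ennreal B * (\<integral>\<^sup>+ z. (\<integral>\<^sup>+ w. R z w * ennreal (G w) \<partial>lborel) \<partial>\<mu>)"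
        by (intro nn_integral_cmult) measurable
      also have "(\<integral>\<^sup>+ z. (\<integral>\<^sup>+ w. R z w * ennreal (G w) \<partial>lborel) \<partial>\<mu>) =
          (\<integral>\<^sup>+ w. (\<integral>\<^sup>+ z. R z w * ennreal (G w) \<partial>\<mu>) \<partial>lborel)"
        by (rule Fubini'[symmetric]) measurable
      also have "\<dots> \<le> (\<integral>\<^sup>+ w. ennreal c * ennreal (G w) \<partial>lborel)"
      proof (rule nn_integral_mono)
        fix w
        have "(\<integral>\<^sup>+ z. R z w * ennreal (G w) \<partial>\<mu>) =
          (\<integral>\<^sup>+ z. R z w \<partial>\<mu>) * ennreal (G w)"
          by (intro nn_integral_multc Rw)
        also have "\<dots> \<le> ennreal c * ennreal (G w)"
        proof (cases "w \<in> \<Omega>")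
          case True
          then show ?thesis by (intro mult_right_mono inner) auto
        qed (simp add: G_def)
        finally show "(\<integral>\<^sup>+ z. R z w * ennreal (G w) \<partial>\<mu>) \<le> ennreal c * ennreal (G w)" .
      qed
      also have "\<dots> = ennreal c * I" unfolding IG by (intro nn_integral_cmult) measurable
      finally have "(\<integral>\<^sup>+ z. ennreal (\<bar>g z\<bar> powr q) \<partial>\<mu>) \<le> ennreal B * (ennreal c * I)"
        by (simp add: mult_left_mono)
      also have "\<dots> = ennreal (c * K1 powr (q / p) * J powr (q / p))"
      proof -
        \<comment> \<open>For J = 0 both sides vanish, as \<open>0 powr x = 0\<close> for every
          \<open>x\<close>.\<close>
        have "J powr (q / p - 1) * J = J powr (q / p)" using J by (cases "J = 0") (auto simp: powr_diff)
        then have "B * (c * J) = c * K1 powr (q / p) * J powr (q / p)"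
          by (simp add: B_def mult_ac)
        then show ?thesis using J c by (simp add: ennreal_mult[symmetric] B_def)
      qed
      finally have "meas_norm \<mu> q g \<le> enn_powr (ennreal (c * K1 powr (q / p) * J powr (q / p))) (1 / q)"
        unfolding meas_norm_def using pq by (intro enn_powr_mono) auto
      also have "\<dots> = ennreal (C' * J powr (1 / p))"
        using c pq J by (simp add: enn_powr_ennreal C'_def powr_mult powr_powr)
      also have "\<dots> = ennreal C' * weighted_norm \<Omega> p \<alpha> g"
      proof -
        have wn: "weighted_norm \<Omega> p \<alpha> g = ennreal (J powr (1 / p))"
          unfolding weighted_norm_def I_def[symmetric] J(1) by (rule enn_powr_ennreal[OF J(2)])
        show ?thesis unfolding wn by (rule ennreal_mult) (auto simp: C'_def)
      qed
      finally show ?thesis .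
    qed
  qed
  ultimately show ?thesis by blast
qed

section \<open>Test functions\<close>

text \<open>A Riemann map followed by a disc automorphism. Having \<phi>(z0) = 0 lets the Schwarz
  lemma keep |\<phi>| away from 1 on the half-size ball around \<open>z0\<close>.\<close>

lemma riemann_map_centred:
  assumes \<Omega>: "open \<Omega>" "simply_connected \<Omega>" "bounded \<Omega>" and z0: "z0 \<in> \<Omega>"
  obtains \<phi> g where "\<phi> holomorphic_on \<Omega>" "g holomorphic_on ball 0 1" "\<phi> z0 = 0"
    "\<And>z. z \<in> \<Omega> \<Longrightarrow> \<phi> z \<in> ball 0 1 \<and> g (\<phi> z) = z"
    "\<And>w. w \<in> ball 0 1 \<Longrightarrow> g w \<in> \<Omega> \<and> \<phi> (g w) = w"
proof -
  have "\<Omega> \<noteq> {}" "\<Omega> \<noteq> UNIV" using z0 \<Omega>(3) by auto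
  then obtain f h where fh: "f holomorphic_on \<Omega>" "h holomorphic_on ball 0 1"
      "\<And>z. z \<in> \<Omega> \<Longrightarrow> f z \<in> ball 0 1 \<and> h (f z) = z"
      "\<And>w. w \<in> ball 0 1 \<Longrightarrow> h w \<in> \<Omega> \<and> f (h w) = w"
    using simply_connected_eq_biholomorphic_to_disc[OF \<Omega>(1)] \<Omega>(2) by metis
  obtain F G where FG: "F (f z0) = 0" "F holomorphic_on ball 0 1" "F ` ball 0 1 \<subseteq> ball 0 1"
      "G holomorphic_on ball 0 1" "G ` ball 0 1 \<subseteq> ball 0 1"
      "\<And>z. z \<in> ball 0 1 \<Longrightarrow> F (G z) = z" "\<And>z. z \<in> ball 0 1 \<Longrightarrow> G (F z) = z"
    using ball_biholomorphism_exists[of "f z0"] fh(3)[OF z0] by blast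
  show ?thesis
  proof (rule that[of "F \<circ> f" "h \<circ> G"])
    show "F \<circ> f holomorphic_on \<Omega>"
      by (rule holomorphic_on_compose_gen[OF fh(1) FG(2)]) (use fh(3) in blast)
    show "h \<circ> G holomorphic_on ball 0 1"
      by (rule holomorphic_on_compose_gen[OF FG(4) fh(2)]) (use FG(5) in blast)
    show "(F \<circ> f) z \<in> ball 0 1 \<and> (h \<circ> G) ((F \<circ> f) z) = z" if "z \<in> \<Omega>" for z
      using fh(3)[OF that] FG(3,7) by (simp add: image_subset_iff)
    show "(h \<circ> G) w \<in> \<Omega> \<and> (F \<circ> f) ((h \<circ> G) w) = w" if "w \<in> ball 0 1" for w
      using fh(4)[of "G w"] FG(5,6) that by (simp add: image_subset_iff)
  qed (simp add: FG(1))
qed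

text \<open>The test function is \<open>(\<phi>')\<^bsup>(2+\<alpha>)/p\<^esup>\<close> for the Riemann map \<open>\<phi>\<close> with \<open>\<phi>(z\<^sub>0) = 0\<close>: since
  \<open>|\<phi>'| \<delta>\<close> is comparable to \<open>1 - |\<phi>|\<^sup>2\<close>, a change of variables turns its weighted norm into the
  integral of \<open>(1 - |w|\<^sup>2)\<^bsup>\<alpha>\<^esup>\<close> over the disc.\<close>

lemma bergman_test_function:
  fixes \<alpha> p :: real
  assumes \<Omega>: "open \<Omega>" "simply_connected \<Omega>" "bounded \<Omega>" and p: "0 < p" and \<alpha>: "-1 < \<alpha>"
  obtains A k where "0 < A" "0 < k"
    "\<And>z0. z0 \<in> \<Omega> \<Longrightarrow> \<exists>f. f holomorphic_on \<Omega> \<and>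
       (\<integral>\<^sup>+ z\<in>\<Omega>. ennreal (cmod (f z) powr p * bdist \<Omega> z powr \<alpha>) \<partial>lborel) \<le> ennreal A \<and>
       (\<forall>z\<in>ball z0 (bdist \<Omega> z0 / 2). k * bdist \<Omega> z0 powr (- ((2 + \<alpha>) / p)) \<le> cmod (f z))"
proof -
  define \<beta> where "\<beta> = (2 + \<alpha>) / p"
  have \<beta>: "0 < \<beta>" using p \<alpha> by (simp add: \<beta>_def)
  define \<kappa> where "\<kappa> = 13 * pi"
  have \<kappa>: "1 \<le> \<kappa>" using pi_gt3 by (simp add: \<kappa>_def)
  define h where "h = (\<lambda>w. indicator (ball 0 1) w * (1 - (cmod w)\<^sup>2) powr \<alpha>)"
  have [measurable]: "ball (0::complex) 1 \<in> sets borel" by simp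
  have h [measurable]: "h \<in> borel_measurable borel" unfolding h_def by measurable
  define I where "I = (\<integral>\<^sup>+ w\<in>ball (0::complex) 1. ennreal ((1 - (cmod w)\<^sup>2) powr \<alpha>) \<partial>lborel)"
  have Ih: "I = (\<integral>\<^sup>+ w\<in>ball (0::complex) 1. ennreal (h w) \<partial>lborel)"
    unfolding I_def h_def by (intro nn_integral_cong) (simp add: indicator_def)
  define J where "J = enn2real I"
  have "I < \<infinity>" using nn_integral_disc_powr_finite[OF \<alpha>] by (simp add: I_def)
  then have J: "I = ennreal J" "0 \<le> J" by (auto simp: J_def)
  \<comment> \<open>The summand 1 ensures positivity; neither \<open>A\<close> nor \<open>k\<close>
    depends on \<open>z0\<close>.\<close>
  define A where "A = \<kappa> powr \<bar>\<alpha>\<bar> * J + 1"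
  \<comment> \<open>The base is the quotient of 3/4, a lower bound for 1 - |\<phi>|^2 on the half
    ball, by (3/2) \<kappa>, where 3/2 bounds \<delta>(z) / \<delta>(z0).\<close>
  define k where "k = (1 / (2 * \<kappa>)) powr \<beta>"
  note pos = bdist_pos[OF \<Omega>(1,3)]
  have main: "\<exists>f. f holomorphic_on \<Omega> \<and>
       (\<integral>\<^sup>+ z\<in>\<Omega>. ennreal (cmod (f z) powr p * bdist \<Omega> z powr \<alpha>) \<partial>lborel) \<le> ennreal A \<and>
       (\<forall>z\<in>ball z0 (bdist \<Omega> z0 / 2). k * bdist \<Omega> z0 powr (- \<beta>) \<le> cmod (f z))"
    if z0: "z0 \<in> \<Omega>" for z0
  proof -
    obtain \<phi> g where \<phi>: "\<phi> holomorphic_on \<Omega>" and g: "g holomorphic_on ball 0 1" and \<phi>0: "\<phi> z0 = 0"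
      and \<phi>g: "\<And>z. z \<in> \<Omega> \<Longrightarrow> \<phi> z \<in> ball 0 1 \<and> g (\<phi> z) = z"
      and g\<phi>: "\<And>w. w \<in> ball 0 1 \<Longrightarrow> g w \<in> \<Omega> \<and> \<phi> (g w) = w"
      using riemann_map_centred[OF \<Omega> z0] by blast
    have inj: "inj_on \<phi> \<Omega>" using \<phi>g by (metis inj_onI)
    have img: "\<phi> ` \<Omega> = ball 0 1" using \<phi>g g\<phi> by (auto simp: image_iff) metis
    have d0: "deriv \<phi> z \<noteq> 0" if "z \<in> \<Omega>" for z
      using holomorphic_injective_imp_regular[OF \<phi> \<Omega>(1) inj that] .
    have upper: "cmod (deriv \<phi> z) * bdist \<Omega> z \<le> 1 - (cmod (\<phi> z))\<^sup>2" if z: "z \<in> \<Omega>" for z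
      by (rule Schwarz_Pick_deriv)
         (use ball_bdist_subset[OF z] pos[OF z] \<phi>g holomorphic_on_subset[OF \<phi>] in auto)
    have lower: "1 - (cmod (\<phi> z))\<^sup>2 \<le> \<kappa> * (cmod (deriv \<phi> z) * bdist \<Omega> z)" if z: "z \<in> \<Omega>" for z
    proof -
      obtain \<zeta> where \<zeta>: "\<zeta> \<notin> \<Omega>" "dist z \<zeta> = bdist \<Omega> z"
        using bdist_attained[OF \<Omega>(1,3)] z by blast
      show ?thesis
        using conformal_deriv_ge_dist_frontier[OF \<Omega>(1) \<phi> g \<phi>g g\<phi> z \<zeta>(1)] \<zeta>(2)
        by (simp add: \<kappa>_def mult_ac)
    qed
    have "deriv \<phi> holomorphic_on \<Omega>" using \<phi> \<Omega>(1) by (rule holomorphic_deriv)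
    \<comment> \<open>An injective holomorphic map has a zero-free derivative, so on a simply
      connected domain its logarithm exists and defines the real power \<beta>.\<close>
    then obtain l where l: "l holomorphic_on \<Omega>" "\<And>z. z \<in> \<Omega> \<Longrightarrow> deriv \<phi> z = exp (l z)"
      using simply_connected_eq_holomorphic_log[OF \<Omega>(1)] \<Omega>(2) d0 by metis
    define f where "f = (\<lambda>z. exp (of_real \<beta> * l z))"
    have f: "cmod (f z) = cmod (deriv \<phi> z) powr \<beta>" if "z \<in> \<Omega>" for z
      unfolding f_def l(2)[OF that] by (simp add: powr_def)
    have "f holomorphic_on \<Omega>" unfolding f_def using l(1) by (intro holomorphic_intros)
    moreover have "(\<integral>\<^sup>+ z\<in>\<Omega>. ennreal (cmod (f z) powr p * bdist \<Omega> z powr \<alpha>) \<partial>lborel) \<le> ennreal A"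
    proof -
      define H where "H = (\<lambda>w. \<kappa> powr \<bar>\<alpha>\<bar> * h w)"
      have "(\<integral>\<^sup>+ z\<in>\<Omega>. ennreal (cmod (f z) powr p * bdist \<Omega> z powr \<alpha>) \<partial>lborel) \<le>
        (\<integral>\<^sup>+ z\<in>\<Omega>. ennreal ((cmod (deriv \<phi> z))\<^sup>2 * H (\<phi> z)) \<partial>lborel)"
      proof (rule nn_integral_mono)
        fix z
        have "cmod (f z) powr p * bdist \<Omega> z powr \<alpha> \<le> (cmod (deriv \<phi> z))\<^sup>2 * H (\<phi> z)" if z: "z \<in> \<Omega>"
        proof -
          define x where "x = cmod (deriv \<phi> z) * bdist \<Omega> z"
          define y where "y = 1 - (cmod (\<phi> z))\<^sup>2"
          have x: "0 < x" using d0[OF z] pos[OF z] by (simp add: x_def)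
          have xy: "x \<le> y" "y \<le> \<kappa> * x" using upper[OF z] lower[OF z] by (simp_all add: x_def y_def)
          \<comment> \<open>The sign of \<alpha> decides which comparison is used: x <= y
            (Schwarz-Pick) for \<alpha> >= 0, and y / \<kappa> <= x (Koebe-type) for \<alpha> <
            0.\<close>
          have "x powr \<alpha> \<le> \<kappa> powr \<bar>\<alpha>\<bar> * y powr \<alpha>"
          proof (cases "0 \<le> \<alpha>")
            case True
            have "x powr \<alpha> \<le> 1 * y powr \<alpha>" using True x xy by (simp add: powr_mono2)
            also have "\<dots> \<le> \<kappa> powr \<bar>\<alpha>\<bar> * y powr \<alpha>"
              using \<kappa> by (intro mult_right_mono ge_one_powr_ge_zero) auto
            finally show ?thesis .
          next
            case False
            then have "x powr \<alpha> \<le> (y / \<kappa>) powr \<alpha>"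
              using x xy \<kappa> by (intro powr_mono2') (auto simp: field_simps)
            then show ?thesis using False x xy \<kappa> by (simp add: powr_divide powr_minus field_simps)
          qed
          moreover have "cmod (f z) powr p * bdist \<Omega> z powr \<alpha> = (cmod (deriv \<phi> z))\<^sup>2 * x powr \<alpha>"
          proof -
            have "cmod (f z) powr p = cmod (deriv \<phi> z) powr (2 + \<alpha>)"
              using p by (simp add: f[OF z] powr_powr \<beta>_def)
            also have "\<dots> = (cmod (deriv \<phi> z))\<^sup>2 * cmod (deriv \<phi> z) powr \<alpha>"
              using d0[OF z] by (simp add: powr_add powr_numeral)
            finally show ?thesis using pos[OF z] by (simp add: x_def powr_mult)
          qed
          moreover have "H (\<phi> z) = \<kappa> powr \<bar>\<alpha>\<bar> * y powr \<alpha>"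
            using \<phi>g[OF z] by (simp add: H_def h_def y_def)
          ultimately show ?thesis by (simp add: mult_left_mono)
        qed
        then show "ennreal (cmod (f z) powr p * bdist \<Omega> z powr \<alpha>) * indicator \<Omega> z \<le>
            ennreal ((cmod (deriv \<phi> z))\<^sup>2 * H (\<phi> z)) * indicator \<Omega> z"
          by (auto simp: indicator_def intro!: ennreal_leI)
      qed
      \<comment> \<open>The factor |\<phi>'|^2 is the Jacobian and the image is always the unit
        disc, so no trace of \<open>z0\<close> remains in the bound.\<close>
      also have "\<dots> \<le> (\<integral>\<^sup>+ w\<in>\<phi> ` \<Omega>. ennreal (H w) \<partial>lborel)"
        by (rule nn_integral_conformal_le[OF \<Omega>(1) \<phi> inj]) (use h in \<open>auto simp: H_def h_def\<close>)
      also have "\<dots> = (\<integral>\<^sup>+ w. ennreal (\<kappa> powr \<bar>\<alpha>\<bar>) * (ennreal (h w) * indicator (ball 0 1) w) \<partial>lborel)"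
        unfolding img H_def by (intro nn_integral_cong) (simp add: ennreal_mult h_def mult.assoc)
      also have "\<dots> = ennreal (\<kappa> powr \<bar>\<alpha>\<bar>) * I"
        unfolding Ih by (intro nn_integral_cmult) measurable
      also have "\<dots> \<le> ennreal A"
        using J by (simp add: A_def ennreal_mult[symmetric] ennreal_leI)
      finally show ?thesis .
    qed
    moreover have "k * bdist \<Omega> z0 powr (- \<beta>) \<le> cmod (f z)" if z: "z \<in> ball z0 (bdist \<Omega> z0 / 2)" for z
    proof -
      define d where "d = bdist \<Omega> z0"
      have d: "0 < d" using pos[OF z0] by (simp add: d_def)
      have sub: "ball z0 d \<subseteq> \<Omega>" using ball_bdist_subset[OF z0] by (simp add: d_def)
      have z\<Omega>: "z \<in> \<Omega>" using z d sub by (auto simp: d_def)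
      \<comment> \<open>\<phi> on the full ball of radius \<delta>(z0), rescaled to the unit disc
        and vanishing at 0: Schwarz gives |\<phi>(z)| <= |z - z0| / d < 1/2.\<close>
      define \<psi> where "\<psi> = (\<lambda>w. \<phi> (z0 + of_real d * w))"
      have in_ball: "z0 + of_real d * w \<in> ball z0 d" if "cmod w < 1" for w
        using that d by (simp add: dist_norm norm_mult)
      have "\<psi> holomorphic_on ball 0 1"
        unfolding \<psi>_def
        by (rule holomorphic_on_compose_gen[OF _ \<phi>, unfolded o_def])
           (use in_ball sub in \<open>auto intro!: holomorphic_intros\<close>)
      moreover have "cmod (\<psi> w) < 1" if "cmod w < 1" for w
        using \<phi>g[of "z0 + of_real d * w"] in_ball[OF that] sub by (auto simp: \<psi>_def)
      moreover define w where "w = (z - z0) / of_real d"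
      have w: "cmod w < 1 / 2"
        using z d by (simp add: w_def norm_divide dist_norm d_def[symmetric] norm_minus_commute field_simps)
      ultimately have "cmod (\<psi> w) \<le> cmod w"
        using Schwarz_Lemma(1)[of \<psi> w] \<phi>0 by (simp add: \<psi>_def)
      moreover have "\<psi> w = \<phi> z" using d by (simp add: \<psi>_def w_def)
      ultimately have "cmod (\<phi> z) \<le> 1 / 2" using w by simp
      then have "(cmod (\<phi> z))\<^sup>2 \<le> (1 / 2)\<^sup>2" by (intro power_mono) auto
      then have "3 / 4 \<le> 1 - (cmod (\<phi> z))\<^sup>2" by (simp add: power2_eq_square)
      also have "\<dots> \<le> \<kappa> * (cmod (deriv \<phi> z) * bdist \<Omega> z)" by (rule lower[OF z\<Omega>])
      also have "\<dots> \<le> \<kappa> * (cmod (deriv \<phi> z) * (3 / 2 * d))"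
        using bdist_lipschitz[of \<Omega> z z0] z \<kappa> by (intro mult_left_mono) (auto simp: d_def)
      finally have "1 / (2 * \<kappa>) / d \<le> cmod (deriv \<phi> z)" using d \<kappa> by (simp add: field_simps)
      then have "(1 / (2 * \<kappa>) / d) powr \<beta> \<le> cmod (f z)"
        unfolding f[OF z\<Omega>] using d \<kappa> \<beta> by (intro powr_mono2) auto
      moreover have "(1 / (2 * \<kappa>) / d) powr \<beta> = k * d powr (- \<beta>)"
        using d \<kappa> by (simp add: k_def powr_divide powr_mult powr_minus_divide)
      ultimately show ?thesis by (simp add: d_def)
    qed
    ultimately show ?thesis by blast
  qed
  have "0 < A" "0 < k" using J \<kappa> by (auto simp: A_def k_def add_nonneg_pos)
  then show ?thesis by (rule that[OF _ _ main[unfolded \<beta>_def]])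
qed

text \<open>A Chebyshev argument: the test function centred at \<open>z\<close> is at least a
  multiple of \<delta>(z)^(-(2 + \<alpha>)/p) on the Whitney ball, while its q-th power has a
  \<mu>-integral bounded independently of \<open>z\<close>.\<close>

lemma carleson_imp_whitney:
  assumes \<Omega>: "open \<Omega>" "simply_connected \<Omega>" "bounded \<Omega>"
    and sets: "sets \<mu> = sets (restrict_space lborel \<Omega>)"
    and pq: "0 < p" "p \<le> q" and \<alpha>: "-1 < \<alpha>" and c0: "0 < c0" and C: "0 < C"
    and car: "\<And>f. f analytic_on \<Omega> \<Longrightarrow> weighted_norm \<Omega> p \<alpha> (\<lambda>z. cmod (f z)) < \<infinity> \<Longrightarrow>
      meas_norm \<mu> q (\<lambda>z. cmod (f z)) \<le> ennreal C * weighted_norm \<Omega> p \<alpha> (\<lambda>z. cmod (f z))"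
  shows "\<exists>c>0. \<forall>z\<in>\<Omega>. \<forall>r. ball z r \<subseteq> \<Omega> \<and> c0 * bdist \<Omega> z \<le> r \<and> r \<le> bdist \<Omega> z / 2 \<longrightarrow>
              emeasure \<mu> (ball z r) \<le> ennreal (c * r powr ((2 + \<alpha>) * q / p))"
proof -
  obtain A k where A: "0 < A" and k: "0 < k" and test:
    "\<And>z0. z0 \<in> \<Omega> \<Longrightarrow> \<exists>f. f holomorphic_on \<Omega> \<and>
       (\<integral>\<^sup>+ z\<in>\<Omega>. ennreal (cmod (f z) powr p * bdist \<Omega> z powr \<alpha>) \<partial>lborel) \<le> ennreal A \<and>
       (\<forall>z\<in>ball z0 (bdist \<Omega> z0 / 2). k * bdist \<Omega> z0 powr (- ((2 + \<alpha>) / p)) \<le> cmod (f z))"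
    by (rule bergman_test_function[OF \<Omega> pq(1) \<alpha>]) (rule that)
  define \<gamma> where "\<gamma> = (2 + \<alpha>) * q / p"
  have \<gamma>: "0 < \<gamma>" using pq \<alpha> by (simp add: \<gamma>_def)
  define R where "R = C * A powr (1 / p)"
  have R: "0 < R" using C A by (simp add: R_def)
  define c where "c = R powr q * k powr (- q) * c0 powr (- \<gamma>)"
  have c: "0 < c" using R k c0 by (simp add: c_def)
  have "emeasure \<mu> (ball z r) \<le> ennreal (c * r powr \<gamma>)"
    if z: "z \<in> \<Omega>" and r: "ball z r \<subseteq> \<Omega>" "c0 * bdist \<Omega> z \<le> r" "r \<le> bdist \<Omega> z / 2" for z r
  proof -
    define d where "d = bdist \<Omega> z"
    have d: "0 < d" using bdist_pos[OF \<Omega>(1,3) z] by (simp add: d_def)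
    obtain f where f: "f holomorphic_on \<Omega>"
      and fA: "(\<integral>\<^sup>+ z\<in>\<Omega>. ennreal (cmod (f z) powr p * bdist \<Omega> z powr \<alpha>) \<partial>lborel) \<le> ennreal A"
      and fk: "\<And>w. w \<in> ball z (d / 2) \<Longrightarrow> k * d powr (- ((2 + \<alpha>) / p)) \<le> cmod (f w)"
      using test[OF z] by (auto simp: d_def)
    have "weighted_norm \<Omega> p \<alpha> (\<lambda>z. cmod (f z)) \<le> enn_powr (ennreal A) (1 / p)"
      unfolding weighted_norm_def using fA pq by (intro enn_powr_mono) auto
    then have wn: "weighted_norm \<Omega> p \<alpha> (\<lambda>z. cmod (f z)) \<le> ennreal (A powr (1 / p))"
      using A by (simp add: enn_powr_ennreal)
    then have "meas_norm \<mu> q (\<lambda>z. cmod (f z)) \<le> ennreal C * weighted_norm \<Omega> p \<alpha> (\<lambda>z. cmod (f z))"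
      using f \<Omega>(1) by (intro car) (auto simp: analytic_on_open intro: le_less_trans)
    also have "\<dots> \<le> ennreal C * ennreal (A powr (1 / p))" by (intro mult_left_mono wn) simp
    also have "\<dots> = ennreal R" using C by (simp add: R_def ennreal_mult)
    finally have le: "(\<integral>\<^sup>+ w. ennreal (cmod (f w) powr q) \<partial>\<mu>) \<le> ennreal (R powr q)"
      unfolding meas_norm_def using pq R by (intro enn_powr_inverse_leD) auto
    have bm: "ball z r \<in> sets \<mu>"
      unfolding sets using r(1) by (auto simp: sets_restrict_space image_iff intro!: exI[of _ "ball z r"])
    have e: "- ((2 + \<alpha>) / p) * q = - \<gamma>" using pq by (simp add: \<gamma>_def field_simps)
    define t where "t = k powr q * d powr (- \<gamma>)"
    have t: "0 < t" using k d by (simp add: t_def)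
    have "ennreal t * emeasure \<mu> (ball z r) = (\<integral>\<^sup>+ w. ennreal t * indicator (ball z r) w \<partial>\<mu>)"
      using bm by (simp add: nn_integral_cmult_indicator)
    also have "\<dots> \<le> (\<integral>\<^sup>+ w. ennreal (cmod (f w) powr q) \<partial>\<mu>)"
    proof (rule nn_integral_mono)
      fix w
      have "t \<le> cmod (f w) powr q" if "w \<in> ball z r"
      proof -
        have "w \<in> ball z (d / 2)" using that r(3) by (simp add: d_def)
        then have "(k * d powr (- ((2 + \<alpha>) / p))) powr q \<le> cmod (f w) powr q"
          using fk k pq by (intro powr_mono2) auto
        moreover have "(k * d powr (- ((2 + \<alpha>) / p))) powr q = t"
          unfolding t_def e[symmetric] using k by (simp add: powr_mult powr_powr)
        ultimately show ?thesis by simp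
      qed
      then show "ennreal t * indicator (ball z r) w \<le> ennreal (cmod (f w) powr q)"
        by (auto simp: indicator_def intro!: ennreal_leI)
    qed
    also note le
    finally have *: "ennreal t * emeasure \<mu> (ball z r) \<le> ennreal (R powr q)" .
    have "emeasure \<mu> (ball z r) = ennreal (1 / t) * (ennreal t * emeasure \<mu> (ball z r))"
      using t by (simp add: mult.assoc[symmetric] ennreal_mult[symmetric])
    also have "\<dots> \<le> ennreal (1 / t) * ennreal (R powr q)" by (intro mult_left_mono *) simp
    also have "\<dots> = ennreal (R powr q * k powr (- q) * d powr \<gamma>)"
      using t k d by (simp add: ennreal_mult[symmetric] t_def powr_minus field_simps)
    \<comment> \<open>The lower Whitney bound c0 \<delta>(z) <= r converts the power of the boundary
      distance into a power of the radius.\<close>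
    also have "\<dots> \<le> ennreal (R powr q * k powr (- q) * (r / c0) powr \<gamma>)"
      using r(2) c0 d \<gamma> by (intro ennreal_leI mult_left_mono powr_mono2) (auto simp: d_def field_simps)
    also have "(r / c0) powr \<gamma> = c0 powr (- \<gamma>) * r powr \<gamma>"
    proof -
      have "0 < c0 * bdist \<Omega> z" using c0 d by (simp add: d_def)
      then have "0 < r" using r(2) by linarith
      then show ?thesis using c0 by (simp add: powr_divide powr_minus field_simps)
    qed
    finally show ?thesis by (simp add: c_def mult.assoc)
  qed
  then show ?thesis using c by (auto simp: \<gamma>_def)
qed

theorem theorem2:
  fixes \<Omega> :: "complex set" and \<mu> :: "complex measure" and p q \<alpha> c0 :: real
  assumes "open \<Omega>" "connected \<Omega>" "\<Omega> \<noteq> {}" "bounded \<Omega>" "simply_connected \<Omega>"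
    and "sets \<mu> = sets (restrict_space lborel \<Omega>)"
    and "0 < p" "p \<le> q" "\<alpha> > -1"
    and "0 < c0" "c0 \<le> 1/2"
  shows "((\<exists>c>0. \<forall>z\<in>\<Omega>. \<forall>r. ball z r \<subseteq> \<Omega> \<and> c0 * bdist \<Omega> z \<le> r \<and> r \<le> bdist \<Omega> z / 2 \<longrightarrow>
              emeasure \<mu> (ball z r) \<le> ennreal (c * r powr ((2 + \<alpha>) * q / p)))
         \<longleftrightarrow>
          (\<forall>C>0. \<exists>C'>0. \<forall>g. quasi_nearly_subharmonic C \<Omega> g \<longrightarrow>
              meas_norm \<mu> q g \<le> ennreal C' * weighted_norm \<Omega> p \<alpha> g))
       \<and>
         ((\<exists>c>0. \<forall>z\<in>\<Omega>. \<forall>r. ball z r \<subseteq> \<Omega> \<and> c0 * bdist \<Omega> z \<le> r \<and> r \<le> bdist \<Omega> z / 2 \<longrightarrow>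
              emeasure \<mu> (ball z r) \<le> ennreal (c * r powr ((2 + \<alpha>) * q / p)))
         \<longleftrightarrow>
          (\<exists>C''>0. \<forall>f. f analytic_on \<Omega> \<and> weighted_norm \<Omega> p \<alpha> (\<lambda>z. cmod (f z)) < \<infinity> \<longrightarrow>
              meas_norm \<mu> q (\<lambda>z. cmod (f z)) \<le> ennreal C'' * weighted_norm \<Omega> p \<alpha> (\<lambda>z. cmod (f z))))"
    (is "(?W \<longleftrightarrow> ?Q) \<and> (_ \<longleftrightarrow> ?A)")
proof -
  have WQ: ?Q if ?W
  proof (intro allI impI)
    fix C :: real assume "0 < C"
    obtain c where c: "0 < c" "\<And>z r. z \<in> \<Omega> \<Longrightarrow> ball z r \<subseteq> \<Omega> \<Longrightarrow> c0 * bdist \<Omega> z \<le> r \<Longrightarrow>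
        r \<le> bdist \<Omega> z / 2 \<Longrightarrow> emeasure \<mu> (ball z r) \<le> ennreal (c * r powr ((2 + \<alpha>) * q / p))"
      using \<open>?W\<close> by blast
    \<comment> \<open>The radius \<delta>(z)/2 is admissible in the Whitney condition because c0 <=
      1/2.\<close>
    have "emeasure \<mu> (ball z (bdist \<Omega> z / 2)) \<le> ennreal (c * (bdist \<Omega> z / 2) powr ((2 + \<alpha>) * q / p))"
      if z: "z \<in> \<Omega>" for z
    proof (rule c(2)[OF z])
      show "ball z (bdist \<Omega> z / 2) \<subseteq> \<Omega>"
        using ball_bdist_subset[OF z] bdist_nonneg[of \<Omega> z] by (auto simp: subset_iff)
      show "c0 * bdist \<Omega> z \<le> bdist \<Omega> z / 2"
        using mult_right_mono[OF assms(11) bdist_nonneg[of \<Omega> z]] by simp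
    qed simp
    then show "\<exists>C'>0. \<forall>g. quasi_nearly_subharmonic C \<Omega> g \<longrightarrow>
        meas_norm \<mu> q g \<le> ennreal C' * weighted_norm \<Omega> p \<alpha> g"
      using assms c(1) \<open>0 < C\<close> by (intro whitney_imp_qns_embedding[where c = c]) auto
  qed
  have QA: ?A if ?Q
  proof -
    \<comment> \<open>The area mean value inequality makes |f| quasi-nearly subharmonic with
      constant 1/pi for every analytic f, so a single instance of (ii) serves all of them.\<close>
    have "0 < 1 / pi" by simp
    then obtain C' where C': "0 < C'" "\<And>g. quasi_nearly_subharmonic (1 / pi) \<Omega> g \<Longrightarrow>
        meas_norm \<mu> q g \<le> ennreal C' * weighted_norm \<Omega> p \<alpha> g"
      using \<open>?Q\<close> by blast
    have "meas_norm \<mu> q (\<lambda>z. cmod (f z)) \<le> ennreal C' * weighted_norm \<Omega> p \<alpha> (\<lambda>z. cmod (f z))"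
      if "f analytic_on \<Omega>" for f
      by (rule C'(2)[OF quasi_nearly_subharmonic_cmod])
         (use that assms(1) in \<open>auto simp: analytic_on_open\<close>)
    then show ?A using C'(1) by blast
  qed
  have AW: ?W if A: ?A
  proof -
    obtain C where C: "0 < C" "\<And>f. f analytic_on \<Omega> \<Longrightarrow> weighted_norm \<Omega> p \<alpha> (\<lambda>z. cmod (f z)) < \<infinity> \<Longrightarrow>
        meas_norm \<mu> q (\<lambda>z. cmod (f z)) \<le> ennreal C * weighted_norm \<Omega> p \<alpha> (\<lambda>z. cmod (f z))"
      using A by blast
    show ?thesis
      using assms C by (intro carleson_imp_whitney[where C = C]) auto
  qed
  show ?thesis using WQ QA AW by blast
qed

end
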